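(* Let $G$ be a finite Abelian group of order $n$. If the Sylow 2-subgroups of $G$ are cyclic and nontrivial, then $\chi(G)\leq n+2$.
   Context: A latin square of order $n$ is an $n\times n$ array in which each row and each column is a permutation of a set of $n$ symbols. A partial transversal of a latin square is a set of cells containing at most one cell from each row, at most one cell from each column, and at most one cell containing each symbol. The chromatic number $\chi(L)$ of a latin square $L$ is the minimum number of partial transversals needed to partition the cells of $L$. For a finite group $G=\{g_0,\dots,g_{n-1}\}$, its Cayley table $L(G)$ is the latin square whose $(i,j)$ entry is $g_ig_j$; $\chi(G)$ denotes $\chi(L(G))$. *)

theory Defs
  imports "HOL-Algebra.Algebra" "HOL-Library.Disjoint_Sets"
begin

text \<open>An array of order \<open>n\<close> is a function on index pairs, of which only the entries
  with both indices in \<open>{..<n}\<close> matter.\<close>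

definition cells :: "nat \<Rightarrow> (nat \<times> nat) set" where
  "cells n = {..<n} \<times> {..<n}"

definition latin_square :: "nat \<Rightarrow> (nat \<Rightarrow> nat \<Rightarrow> 'a) \<Rightarrow> bool" where
  "latin_square n L \<longleftrightarrow> (\<exists>S. finite S \<and> card S = n \<and>
     (\<forall>i<n. bij_betw (\<lambda>j. L i j) {..<n} S) \<and>
     (\<forall>j<n. bij_betw (\<lambda>i. L i j) {..<n} S))"

text \<open>The three injectivity conditions say that no row, no column and no symbol,
  respectively, is used by two different cells of \<open>T\<close>.\<close>

definition partial_transversal ::
    "nat \<Rightarrow> (nat \<Rightarrow> nat \<Rightarrow> 'a) \<Rightarrow> (nat \<times> nat) set \<Rightarrow> bool" where
  "partial_transversal n L T \<longleftrightarrow> T \<subseteq> cells n \<and>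
     inj_on fst T \<and> inj_on snd T \<and> inj_on (\<lambda>(i, j). L i j) T"

definition chromatic_number :: "nat \<Rightarrow> (nat \<Rightarrow> nat \<Rightarrow> 'a) \<Rightarrow> nat" where
  "chromatic_number n L = (LEAST k. \<exists>P. partition_on (cells n) P \<and>
     (\<forall>T\<in>P. partial_transversal n L T) \<and> card P = k)"

text \<open>The minimum exists, since the partition into single cells is always admissible.\<close>

lemma chromatic_number_attained:
  "\<exists>P. partition_on (cells n) P \<and> (\<forall>T\<in>P. partial_transversal n L T) \<and>
       card P = chromatic_number n L"
proof -
  have "partition_on (cells n) ((\<lambda>c. {c}) ` cells n)"
    by (auto simp: partition_on_def disjoint_def)
  moreover have "\<forall>T\<in>(\<lambda>c. {c}) ` cells n. partial_transversal n L T"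
    by (auto simp: partial_transversal_def)
  ultimately have "\<exists>k P. partition_on (cells n) P \<and>
      (\<forall>T\<in>P. partial_transversal n L T) \<and> card P = k"
    by metis
  then show ?thesis
    unfolding chromatic_number_def by (rule LeastI_ex)
qed

text \<open>\<open>g\<close> enumerates the carrier of \<open>G\<close> as \<open>g 0, \<dots>, g (n - 1)\<close>.\<close>

definition cayley_table ::
    "('a, 'b) monoid_scheme \<Rightarrow> (nat \<Rightarrow> 'a) \<Rightarrow> nat \<Rightarrow> nat \<Rightarrow> 'a" where
  "cayley_table G g i j = g i \<otimes>\<^bsub>G\<^esub> g j"

lemma latin_square_cayley_table:
  assumes "group G" and g: "bij_betw g {..<n} (carrier G)"
  shows "latin_square n (cayley_table G g)"
proof -
  interpret group G by fact
  have mem: "g i \<in> carrier G" if "i < n" for i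
    using g that by (auto simp: bij_betw_def)
  have "bij_betw (\<lambda>y. x \<otimes>\<^bsub>G\<^esub> y) (carrier G) (carrier G)" if "x \<in> carrier G" for x
    by (rule bij_betw_byWitness[where f' = "\<lambda>y. inv\<^bsub>G\<^esub> x \<otimes>\<^bsub>G\<^esub> y"])
       (use that in \<open>auto simp: m_assoc[symmetric]\<close>)
  moreover have "bij_betw (\<lambda>y. y \<otimes>\<^bsub>G\<^esub> x) (carrier G) (carrier G)" if "x \<in> carrier G" for x
    by (rule bij_betw_byWitness[where f' = "\<lambda>y. y \<otimes>\<^bsub>G\<^esub> inv\<^bsub>G\<^esub> x"])
       (use that in \<open>auto simp: m_assoc\<close>)
  ultimately have "bij_betw ((\<lambda>y. g i \<otimes>\<^bsub>G\<^esub> y) \<circ> g) {..<n} (carrier G)"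
    "bij_betw ((\<lambda>y. y \<otimes>\<^bsub>G\<^esub> g i) \<circ> g) {..<n} (carrier G)" if "i < n" for i
    using bij_betw_trans[OF g] mem[OF that] by metis+
  then have "\<forall>i<n. bij_betw (\<lambda>j. cayley_table G g i j) {..<n} (carrier G)"
    "\<forall>j<n. bij_betw (\<lambda>i. cayley_table G g i j) {..<n} (carrier G)"
    by (simp_all add: cayley_table_def comp_def)
  moreover have "finite (carrier G)" "card (carrier G) = n"
    using bij_betw_finite[OF g] bij_betw_same_card[OF g] by auto
  ultimately show ?thesis unfolding latin_square_def by blast
qed

text \<open>Intended for a prime \<open>p\<close> and a finite group \<open>G\<close>.\<close>

definition sylow_subgroup :: "nat \<Rightarrow> 'a set \<Rightarrow> ('a, 'b) monoid_scheme \<Rightarrow> bool" where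
  "sylow_subgroup p P G \<longleftrightarrow> subgroup P G \<and> card P = p ^ multiplicity p (order G)"

end

theory Submission
  imports Defs "HOL-Number_Theory.Cong"
begin

text \<open>
  Write \<open>n\<close> for the order of \<open>G\<close>. There are a subgroup \<open>V\<close> of odd order and an element \<open>d\<close>
  generating \<open>G / V\<close>, a cyclic group of order \<open>2 m\<close>, such that \<open>V\<close> has a harmonious sequence (cyclically
  consecutive products are distinct) and a map \<open>f\<close> for which \<open>f x\<close>, \<open>f x \<otimes> x\<close> and \<open>f x \<otimes> f x \<otimes> x\<close> are
  all injective: both properties survive an extension of \<open>V\<close> with quotient
  \<open>\<int>/p \<times> \<int>/p\<close>, \<open>p\<close> an odd prime, and when no such extension is left then \<open>G / V\<close> is cyclic.

  The harmonious sequence extends to a cyclic enumeration \<open>R\<close> of \<open>G\<close> in which all \<open>2 n\<close> cells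
  \<open>(R i, R i)\<close>, \<open>(R i, R (i + 1))\<close> form a Moebius ladder: consecutive cells share a row or a column,
  antipodal cells share their symbol, and there are no other conflicts. The translates of this
  ladder by \<open>(\<one>, h)\<close>, where \<open>h\<close> ranges over the \<open>n / 2\<close> elements of the subgroup of index 2, cover
  the Cayley table. A ladder becomes bipartite when two antipodal cells are removed; so \<open>n\<close> partial
  transversals cover everything but one antipodal pair per ladder. With \<open>f\<close> and an explicit partial
  transversal of \<open>\<int>/2m\<close>, the removed pairs can be chosen to form two further partial transversals.
\<close>

section \<open>Subgroups extended by one generator\<close>

locale finite_comm_group = comm_group +
  assumes finite_carrier: "finite (carrier G)"
begin

text \<open>For a subgroup \<open>V\<close> this is the subgroup generated by \<open>V\<close> and
  \<open>t\<close>; natural exponents suffice because the group is finite.\<close>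

definition adjoin :: "'a set \<Rightarrow> 'a \<Rightarrow> 'a set" where
  "adjoin V t = {v \<otimes> t [^] (k::nat) | v k. v \<in> V}"

lemma sub_carrier: "subgroup V G \<Longrightarrow> v \<in> V \<Longrightarrow> v \<in> carrier G"
  by (rule subgroup.mem_carrier)

lemma sub_mult: "subgroup V G \<Longrightarrow> v \<in> V \<Longrightarrow> w \<in> V \<Longrightarrow> v \<otimes> w \<in> V"
  by (rule subgroup.m_closed)

lemma sub_pow: "subgroup V G \<Longrightarrow> v \<in> V \<Longrightarrow> v [^] (k::nat) \<in> V"
  by (induction k) (simp_all add: subgroup.one_closed sub_mult)

lemma sub_cancel:
  assumes V: "subgroup V G" and "v \<in> V" "x \<in> carrier G" "v \<otimes> x \<in> V"
  shows "x \<in> V"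
proof -
  have "x = inv v \<otimes> (v \<otimes> x)"
    using assms sub_carrier[OF V] by (simp add: m_assoc[symmetric])
  then show ?thesis
    using assms by (metis sub_mult subgroup.m_inv_closed)
qed

lemma sub_finite: "subgroup V G \<Longrightarrow> finite V"
  using finite_carrier finite_subset subgroup.subset by blast

lemma sub_card_pos: "subgroup V G \<Longrightarrow> 0 < card V"
  using sub_finite card_gt_0_iff subgroup.one_closed by blast

lemma pow_card_sub:
  assumes V: "subgroup V G" and "v \<in> V"
  shows "v [^] card V = \<one>"
proof -
  interpret H: group "G\<lparr>carrier := V\<rparr>"
    by (rule subgroup_imp_group[OF V])
  show ?thesis
    using H.pow_order_eq_1[of v] assms(2) by (simp add: order_def nat_pow_def)
qed

text \<open>In odd order, raising to the power \<open>(card V + 1) / 2\<close> undoes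
  squaring.\<close>

lemma inj_on_square:
  assumes V: "subgroup V G" and "odd (card V)"
  shows "inj_on (\<lambda>v. v \<otimes> v) V"
proof (rule inj_on_inverseI)
  fix v assume v: "v \<in> V"
  have "(v \<otimes> v) [^] (Suc (card V) div 2) = v [^] (2 * (Suc (card V) div 2))"
    using sub_carrier[OF V v] by (simp add: nat_pow_distrib nat_pow_mult mult_2)
  also have "\<dots> = v [^] Suc (card V)"
    using assms(2) by simp
  also have "\<dots> = v"
    using pow_card_sub[OF V v] sub_carrier[OF V v] by simp
  finally show "(v \<otimes> v) [^] (Suc (card V) div 2) = v" .
qed

lemma adjoinI: "v \<in> V \<Longrightarrow> v \<otimes> t [^] (k::nat) \<in> adjoin V t"
  unfolding adjoin_def by blast

lemma sub_adjoin:
  assumes V: "subgroup V G" and t: "t \<in> carrier G"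
  shows "subgroup (adjoin V t) G"
proof (rule subgroupI)
  show "adjoin V t \<subseteq> carrier G" "adjoin V t \<noteq> {}"
    using sub_carrier[OF V] t subgroup.one_closed[OF V] by (auto simp: adjoin_def)
next
  fix x y assume "x \<in> adjoin V t" "y \<in> adjoin V t"
  then obtain v w and k l :: nat where *: "v \<in> V" "w \<in> V"
      "x = v \<otimes> t [^] k" "y = w \<otimes> t [^] l"
    unfolding adjoin_def by blast
  have "x \<otimes> y = (v \<otimes> w) \<otimes> t [^] (k + l)"
    using * t sub_carrier[OF V] by (simp add: m_ac nat_pow_mult[symmetric])
  then show "x \<otimes> y \<in> adjoin V t"
    using * sub_mult[OF V] adjoinI by metis
next
  fix x assume "x \<in> adjoin V t"
  then obtain v and k :: nat where *: "v \<in> V" "x = v \<otimes> t [^] k"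
    unfolding adjoin_def by blast
  define o' where "o' = order G"
  have "0 < o'"
    using finite_carrier order_gt_0_iff_finite o'_def by blast
  \<comment> \<open>The exponent \<open>(o' - 1) * k\<close> stands for \<open>-k\<close>; later
    proofs avoid negative exponents in the same way.\<close>
  then have e: "k + (o' - 1) * k = o' * k"
    by (cases o') auto
  have "x \<otimes> (inv v \<otimes> t [^] ((o' - 1) * k)) = t [^] (k + (o' - 1) * k)"
    using * t sub_carrier[OF V] by (simp add: m_ac nat_pow_mult[symmetric])
      (simp add: m_assoc[symmetric])
  also have "\<dots> = \<one>"
    unfolding e using t by (simp add: nat_pow_pow[symmetric] o'_def pow_order_eq_1)
  finally have "inv x = inv v \<otimes> t [^] ((o' - 1) * k)"
    using * t sub_carrier[OF V] by (metis inv_closed inv_equality m_closed m_comm nat_pow_closed)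
  then show "inv x \<in> adjoin V t"
    using * subgroup.m_inv_closed[OF V] adjoinI by metis
qed

lemma sub_adjoin_subset:
  assumes "subgroup V G" "t \<in> carrier G"
  shows "V \<subseteq> adjoin V t"
proof
  fix v assume "v \<in> V"
  then show "v \<in> adjoin V t"
    using adjoinI[of v V t 0] sub_carrier assms by simp
qed

lemma gen_in_adjoin: "subgroup V G \<Longrightarrow> t \<in> carrier G \<Longrightarrow> t \<in> adjoin V t"
  using adjoinI[of \<one> V t 1] subgroup.one_closed by fastforce

lemma gen_pow_in_adjoin: "subgroup V G \<Longrightarrow> t \<in> carrier G \<Longrightarrow> t [^] (k::nat) \<in> adjoin V t"
  using sub_pow[OF sub_adjoin] gen_in_adjoin by blast

lemma adjoin_least:
  assumes "subgroup W G" "V \<subseteq> W" "t \<in> W"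
  shows "adjoin V t \<subseteq> W"
  using assms sub_mult sub_pow unfolding adjoin_def by blast

text \<open>The order of the coset of \<open>t\<close> in the quotient by \<open>V\<close>, stated
  without forming a quotient group.\<close>

definition rel_order :: "'a set \<Rightarrow> 'a \<Rightarrow> nat \<Rightarrow> bool" where
  "rel_order V t N \<longleftrightarrow> 0 < N \<and> (\<forall>k::nat. t [^] k \<in> V \<longleftrightarrow> N dvd k)"

lemma ex_rel_order:
  assumes V: "subgroup V G" and t: "t \<in> carrier G"
  obtains N where "rel_order V t N"
proof -
  define N where "N = (LEAST k::nat. 0 < k \<and> t [^] k \<in> V)"
  have "0 < order G \<and> t [^] order G \<in> V"
    using t V finite_carrier order_gt_0_iff_finite
    by (simp add: pow_order_eq_1 subgroup.one_closed)
  then have N: "0 < N \<and> t [^] N \<in> V"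
    unfolding N_def by (rule LeastI[where P = "\<lambda>k::nat. 0 < k \<and> t [^] k \<in> V"])
  have least: "N \<le> k" if "0 < k" "t [^] k \<in> V" for k
    unfolding N_def using that by (intro Least_le) auto
  have "N dvd k" if "t [^] k \<in> V" for k
  proof (rule ccontr)
    assume "\<not> N dvd k"
    then have pos: "0 < k mod N"
      by (simp add: dvd_eq_mod_eq_0)
    have "(t [^] N) [^] (k div N) \<otimes> t [^] (k mod N) = t [^] k"
      using t by (simp add: nat_pow_pow nat_pow_mult)
    then have "t [^] (k mod N) \<in> V"
      using sub_cancel[OF V sub_pow[OF V]] N that t by (metis nat_pow_closed)
    then show False
      using N least[OF pos] by (meson mod_less_divisor not_le)
  qed
  moreover have "t [^] k \<in> V" if "N dvd k" for k
    using that N sub_pow[OF V] t by (auto simp: dvd_def nat_pow_pow[symmetric])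
  ultimately show ?thesis
    using N that unfolding rel_order_def by blast
qed

lemma rel_order_cong:
  assumes V: "subgroup V G" and t: "t \<in> carrier G" and N: "rel_order V t N"
    and vw: "v \<in> V" "w \<in> V" and eq: "v \<otimes> t [^] (a::nat) = w \<otimes> t [^] (b::nat)"
  shows "[a = b] (mod N)"
proof -
  have c: "v \<in> carrier G" "w \<in> carrier G"
    using vw sub_carrier[OF V] by auto
  have "0 < N"
    using N by (simp add: rel_order_def)
  then have e: "b + (N - 1) * b = N * b"
    by (cases N) auto
  have "v \<otimes> t [^] (a + (N - 1) * b) = (v \<otimes> t [^] a) \<otimes> t [^] ((N - 1) * b)"
    using c t by (simp add: m_ac nat_pow_mult[symmetric])
  also have "\<dots> = w \<otimes> t [^] (b + (N - 1) * b)"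
    unfolding eq using c t by (simp add: m_ac nat_pow_mult[symmetric])
  also have "\<dots> \<in> V"
    unfolding e using N vw sub_mult[OF V] by (simp add: rel_order_def)
  finally have "t [^] (a + (N - 1) * b) \<in> V"
    using sub_cancel[OF V vw(1)] t by simp
  then have "N dvd a + (N - 1) * b"
    using N by (simp add: rel_order_def)
  then have "[a + (N - 1) * b = b + (N - 1) * b] (mod N)"
    unfolding e by (simp add: cong_def)
  then show ?thesis
    by (simp add: cong_add_rcancel_nat)
qed

text \<open>Exponents of \<open>t\<close> can be reduced modulo \<open>N\<close>, since powers of
  \<open>t [^] N\<close> lie in \<open>V\<close> and move into the first factor.\<close>

lemma bij_betw_adjoin:
  assumes V: "subgroup V G" and t: "t \<in> carrier G" and N: "rel_order V t N"
  shows "bij_betw (\<lambda>(v, k). v \<otimes> t [^] k) (V \<times> {..<N}) (adjoin V t)"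
  unfolding bij_betw_def
proof
  show "inj_on (\<lambda>(v, k). v \<otimes> t [^] k) (V \<times> {..<N})"
  proof (clarsimp simp: inj_on_def)
    fix v w k l assume *: "v \<in> V" "w \<in> V" "k < N" "l < N"
      "v \<otimes> t [^] k = w \<otimes> t [^] l"
    then have "k = l"
      using rel_order_cong[OF V t N] by (metis cong_less_modulus_unique_nat)
    then show "v = w \<and> k = l"
      using * t sub_carrier[OF V] by simp
  qed
  show "(\<lambda>(v, k). v \<otimes> t [^] k) ` (V \<times> {..<N}) = adjoin V t"
  proof
    show "(\<lambda>(v, k). v \<otimes> t [^] k) ` (V \<times> {..<N}) \<subseteq> adjoin V t"
      by (auto intro: adjoinI)
    show "adjoin V t \<subseteq> (\<lambda>(v, k). v \<otimes> t [^] k) ` (V \<times> {..<N})"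
    proof
      fix x assume "x \<in> adjoin V t"
      then obtain v and k :: nat where *: "v \<in> V" "x = v \<otimes> t [^] k"
        unfolding adjoin_def by blast
      have pN: "0 < N" "t [^] N \<in> V"
        using N by (auto simp: rel_order_def)
      have "t [^] k = (t [^] N) [^] (k div N) \<otimes> t [^] (k mod N)"
        using t by (simp add: nat_pow_pow nat_pow_mult)
      then have "x = (v \<otimes> (t [^] N) [^] (k div N)) \<otimes> t [^] (k mod N)"
        using * t sub_carrier[OF V] by (simp add: m_assoc)
      moreover have "v \<otimes> (t [^] N) [^] (k div N) \<in> V" "k mod N < N"
        using * pN sub_mult[OF V] sub_pow[OF V] by auto
      ultimately show "x \<in> (\<lambda>(v, k). v \<otimes> t [^] k) ` (V \<times> {..<N})"
        by (auto intro!: image_eqI[where x = "(v \<otimes> (t [^] N) [^] (k div N), k mod N)"])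
    qed
  qed
qed

lemma card_adjoin:
  assumes "subgroup V G" "t \<in> carrier G" "rel_order V t N"
  shows "card (adjoin V t) = N * card V"
  using bij_betw_same_card[OF bij_betw_adjoin[OF assms]] by (simp add: card_cartesian_product mult.commute)

section \<open>Harmonious sequences and strong maps\<close>

text \<open>Periodic indexing by all natural numbers encodes the cyclic order: last times first is
  just another consecutive product.\<close>

definition harmonious :: "'a set \<Rightarrow> (nat \<Rightarrow> 'a) \<Rightarrow> bool" where
  "harmonious V u \<longleftrightarrow> range u \<subseteq> V \<and> (\<forall>i j. u i = u j \<longleftrightarrow> [i = j] (mod card V)) \<and>
     (\<forall>i j. u i \<otimes> u (Suc i) = u j \<otimes> u (Suc j) \<longrightarrow> [i = j] (mod card V))"

lemma cong_mult_iff_nat: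
  "[i = j] (mod N * v) \<longleftrightarrow> i mod N = j mod N \<and> [i div N = j div N] (mod v)" for i j N v :: nat
proof
  assume "[i = j] (mod N * v)"
  then show "i mod N = j mod N \<and> [i div N = j div N] (mod v)"
    unfolding cong_def
  proof (cases "N = 0")
    case False
    assume eq: "i mod (N * v) = j mod (N * v)"
    have "k mod N = k mod (N * v) mod N" "k div N mod v = k mod (N * v) div N" for k
      using False by (simp_all add: mod_mod_cancel mod_mult2_eq)
    then show "i mod N = j mod N \<and> i div N mod v = j div N mod v"
      using eq by metis
  qed simp
next
  assume "i mod N = j mod N \<and> [i div N = j div N] (mod v)"
  then show "[i = j] (mod N * v)"
    by (simp add: cong_def mod_mult2_eq)
qed

text \<open>Each term of \<open>u\<close> becomes a block of \<open>N\<close> terms, multiplied by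
  successive powers of \<open>t\<close>. Inside a block the \<open>V\<close>-part of a consecutive
  product is the square of a term of \<open>u\<close>; across a boundary it is a consecutive product
  of \<open>u\<close>. Odd \<open>N\<close> lets the power of \<open>t\<close> reveal the position
  in the block, and odd \<open>card V\<close> makes squaring injective.\<close>

lemma harmonious_adjoin:
  assumes V: "subgroup V G" and odd: "odd (card V)" and u: "harmonious V u"
    and t: "t \<in> carrier G" and N: "rel_order V t N" and "odd N"
  shows "\<exists>u'. harmonious (adjoin V t) u'"
proof -
  define u' where "u' i = u (i div N) \<otimes> t [^] (i mod N)" for i
  have uV: "u i \<in> V" and uG: "u i \<in> carrier G" for i
    using u sub_carrier[OF V] by (auto simp: harmonious_def)
  have "0 < N"
    using N by (simp add: rel_order_def)
  have modN: "i mod N = j mod N" if "v \<otimes> t [^] (i mod N) = w \<otimes> t [^] (j mod N)"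
    "v \<in> V" "w \<in> V" for v w i j
    using rel_order_cong[OF V t N that(2,3,1)] by (simp add: cong_def)
  have "[i = j] (mod N * card V)" if "u' i = u' j" for i j
  proof -
    have "i mod N = j mod N"
      using that modN uV unfolding u'_def by blast
    moreover from this have "u (i div N) = u (j div N)"
      using that uG t by (simp add: u'_def)
    ultimately show ?thesis
      using u by (simp add: cong_mult_iff_nat harmonious_def)
  qed
  moreover have "u' i = u' j" if "[i = j] (mod N * card V)" for i j
  proof -
    have "i mod N = j mod N" "u (i div N) = u (j div N)"
      using that u by (auto simp: cong_mult_iff_nat harmonious_def)
    then show ?thesis
      by (simp add: u'_def)
  qed
  moreover have "[i = j] (mod N * card V)" if eq: "u' i \<otimes> u' (Suc i) = u' j \<otimes> u' (Suc j)" for i j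
  proof -
    \<comment> \<open>At a block boundary the exponent is \<open>(N - 1) + 0\<close>, which agrees
      modulo \<open>N\<close> with the value \<open>2 * (i mod N) + 1\<close> valid
      elsewhere.\<close>
    define x e where "x i = u (i div N) \<otimes> u (if Suc (i mod N) = N then Suc (i div N) else i div N)"
      and "e i = (if Suc (i mod N) = N then i mod N else 2 * (i mod N) + 1)" for i
    have xV: "x i \<in> V" and xG: "x i \<in> carrier G" for i
      using uV sub_mult[OF V] sub_carrier[OF V] by (auto simp: x_def)
    have prod: "u' i \<otimes> u' (Suc i) = x i \<otimes> t [^] e i" for i
    proof (cases "Suc (i mod N) = N")
      case True
      then have "Suc i mod N = 0" "Suc i div N = Suc (i div N)"
        using \<open>0 < N\<close> by (simp_all add: mod_Suc div_Suc)
      then show ?thesis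
        using True uG t by (simp add: u'_def x_def e_def m_ac)
    next
      case False
      then have "Suc i mod N = Suc (i mod N)" "Suc i div N = i div N"
        using \<open>0 < N\<close> by (simp_all add: mod_Suc div_Suc)
      moreover have "2 * (i mod N) + 1 = i mod N + Suc (i mod N)"
        by simp
      ultimately show ?thesis
        using False uG t by (simp add: u'_def x_def e_def m_ac mult_2 nat_pow_mult[symmetric]
            del: nat_pow_Suc)
    qed
    have "[e i = 2 * (i mod N) + 1] (mod N)" for i
    proof (cases "Suc (i mod N) = N")
      case True
      then have "2 * (i mod N) + 1 = i mod N + N"
        by simp
      then have "[2 * (i mod N) + 1 = i mod N] (mod N)"
        by (simp only: cong_def mod_add_self2)
      from cong_sym[OF this] show ?thesis
        using True by (simp add: e_def)
    qed (simp add: e_def)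
    moreover have "[e i = e j] (mod N)"
      using rel_order_cong[OF V t N xV xV] eq unfolding prod by blast
    ultimately have "[2 * (i mod N) + 1 = 2 * (j mod N) + 1] (mod N)"
      by (meson cong_sym cong_trans)
    then have "[i mod N = j mod N] (mod N)"
      using \<open>odd N\<close> by (simp add: cong_add_rcancel_nat cong_mult_lcancel_nat
          flip: One_nat_def)
    then have r: "i mod N = j mod N"
      by (simp add: cong_def)
    then have "e i = e j"
      by (simp add: e_def)
    then have "x i = x j"
      using eq xG t unfolding prod by simp
    then have "[i div N = j div N] (mod card V)"
      using r u inj_onD[OF inj_on_square[OF V odd], OF _ uV uV]
      by (auto simp: x_def harmonious_def split: if_splits)
    then show ?thesis
      using r by (simp add: cong_mult_iff_nat)
  qed
  moreover have "range u' \<subseteq> adjoin V t"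
    using adjoinI[OF uV] by (auto simp: u'_def)
  ultimately have "harmonious (adjoin V t) u'"
    unfolding harmonious_def card_adjoin[OF V t N] by blast
  then show ?thesis
    by blast
qed

text \<open>A complete mapping with one more condition. The three injectivities will separate the
  rows, columns and symbols of the cells removed from the ladders.\<close>

definition strong_map :: "'a set \<Rightarrow> ('a \<Rightarrow> 'a) \<Rightarrow> bool" where
  "strong_map V f \<longleftrightarrow> f ` V \<subseteq> V \<and> inj_on f V \<and> inj_on (\<lambda>x. f x \<otimes> x) V \<and>
     inj_on (\<lambda>x. f x \<otimes> f x \<otimes> x) V"

definition good :: "'a set \<Rightarrow> bool" where
  "good V \<longleftrightarrow> subgroup V G \<and> odd (card V) \<and> (\<exists>u. harmonious V u) \<and> (\<exists>f. strong_map V f)"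

text \<open>The cosets of \<open>t\<close> and \<open>t'\<close> form a basis of a copy of Z/p x Z/p
  inside the quotient by \<open>V\<close>.\<close>

definition independent :: "'a set \<Rightarrow> nat \<Rightarrow> 'a \<Rightarrow> 'a \<Rightarrow> bool" where
  "independent V p t t' \<longleftrightarrow> (\<forall>i j::nat. t [^] i \<otimes> t' [^] j \<in> V \<longleftrightarrow> p dvd i \<and> p dvd j)"

lemma independent_cong:
  assumes V: "subgroup V G" and t: "t \<in> carrier G" "t' \<in> carrier G"
    and ind: "independent V p t t'" and "0 < p"
    and vw: "v \<in> V" "w \<in> V"
    and eq: "v \<otimes> (t [^] (i::nat) \<otimes> t' [^] (j::nat)) = w \<otimes> (t [^] (k::nat) \<otimes> t' [^] (l::nat))"
  shows "[i = k] (mod p) \<and> [j = l] (mod p)"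
proof -
  have c: "v \<in> carrier G" "w \<in> carrier G"
    using vw sub_carrier[OF V] by auto
  have e: "x + (p - 1) * x = p * x" for x
    using \<open>0 < p\<close> by (cases p) auto
  have "v \<otimes> (t [^] (i + (p - 1) * k) \<otimes> t' [^] (j + (p - 1) * l))
      = (v \<otimes> (t [^] i \<otimes> t' [^] j)) \<otimes> (t [^] ((p - 1) * k) \<otimes> t' [^] ((p - 1) * l))"
    using c t by (simp add: m_ac nat_pow_mult[symmetric])
  also have "\<dots> = w \<otimes> (t [^] (k + (p - 1) * k) \<otimes> t' [^] (l + (p - 1) * l))"
    unfolding eq using c t by (simp add: m_ac nat_pow_mult[symmetric])
  also have "\<dots> \<in> V"
    unfolding e using ind vw sub_mult[OF V] by (simp add: independent_def)
  finally have "t [^] (i + (p - 1) * k) \<otimes> t' [^] (j + (p - 1) * l) \<in> V"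
    using sub_cancel[OF V vw(1)] t by simp
  then have "p dvd i + (p - 1) * k" "p dvd j + (p - 1) * l"
    using ind by (auto simp: independent_def)
  then have "[i + (p - 1) * k = k + (p - 1) * k] (mod p)" "[j + (p - 1) * l = l + (p - 1) * l] (mod p)"
    unfolding e by (simp_all add: cong_def)
  then show ?thesis
    by (simp add: cong_add_rcancel_nat)
qed

lemma independent_rel_order:
  assumes V: "subgroup V G" and t: "t \<in> carrier G" "t' \<in> carrier G"
    and ind: "independent V p t t'" and "0 < p"
  shows "rel_order V t p" and "rel_order (adjoin V t) t' p"
proof -
  have "t [^] k \<in> V \<longleftrightarrow> p dvd k" for k :: nat
    using ind[unfolded independent_def, rule_format, of k 0] t by simp
  then show "rel_order V t p"
    using \<open>0 < p\<close> by (simp add: rel_order_def)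
  have "p dvd k" if mem: "t' [^] k \<in> adjoin V t" for k :: nat
  proof -
    obtain v and i :: nat where "v \<in> V" "t' [^] k = v \<otimes> t [^] i"
      using mem unfolding adjoin_def by blast
    then have "\<one> \<otimes> (t [^] (0::nat) \<otimes> t' [^] k) = v \<otimes> (t [^] i \<otimes> t' [^] (0::nat))"
      using t sub_carrier[OF V] by simp
    then have "[k = 0] (mod p)"
      using independent_cong[OF V t ind \<open>0 < p\<close> subgroup.one_closed[OF V] \<open>v \<in> V\<close>] by blast
    then show ?thesis
      by (simp add: cong_0_iff)
  qed
  moreover have "t' [^] k \<in> adjoin V t" if "p dvd k" for k :: nat
    using that ind[unfolded independent_def, rule_format, of 0 k] t sub_adjoin_subset[OF V t(1)]
    by auto
  ultimately show "rel_order (adjoin V t) t' p"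
    using \<open>0 < p\<close> by (auto simp: rel_order_def)
qed

text \<open>
  The action \<open>(b, c) \<mapsto> (c, b + c)\<close> on exponents has matrix \<open>M\<close> such that \<open>M\<close>, \<open>M + 1\<close> and
  \<open>2 M + 1\<close> are invertible over the integers, so it works for every prime at once.
\<close>

lemma strong_map_adjoin:
  assumes V: "subgroup V G" and f: "strong_map V f"
    and t: "t \<in> carrier G" "t' \<in> carrier G" and ind: "independent V p t t'" and "0 < p"
  shows "\<exists>f'. strong_map (adjoin (adjoin V t) t') f'"
proof -
  define W where "W = adjoin (adjoin V t) t'"
  \<comment> \<open>Coordinates on the extension: \<open>D\<close> lists the unique normal forms and
    \<open>e\<close> evaluates them, so that a map can be prescribed on exponents.\<close>
  define e where "e = (\<lambda>(v, b::nat, c::nat). v \<otimes> (t [^] b \<otimes> t' [^] c))"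
  define D where "D = V \<times> {..<p} \<times> {..<p}"
  have fV: "f v \<in> V" and fG: "f v \<in> carrier G" and vG: "v \<in> carrier G" if "v \<in> V" for v
    using that f sub_carrier[OF V] by (auto simp: strong_map_def)
  have "bij_betw (\<lambda>((v, b), c). v \<otimes> t [^] b \<otimes> t' [^] c) ((V \<times> {..<p}) \<times> {..<p}) W"
  proof -
    have "bij_betw (map_prod (\<lambda>(v, b). v \<otimes> t [^] b) id) ((V \<times> {..<p}) \<times> {..<p}) (adjoin V t \<times> {..<p})"
      using bij_betw_adjoin[OF V t(1) independent_rel_order(1)[OF V t ind \<open>0 < p\<close>]]
      by (intro bij_betw_map_prod) auto
    from bij_betw_trans[OF this bij_betw_adjoin[OF sub_adjoin[OF V t(1)] t(2)
          independent_rel_order(2)[OF V t ind \<open>0 < p\<close>]]]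
    show ?thesis
      unfolding W_def by (rule bij_betw_cong[THEN iffD1, rotated]) auto
  qed
  moreover have "bij_betw (\<lambda>(v, b, c). ((v, b), c)) D ((V \<times> {..<p}) \<times> {..<p})"
    unfolding D_def by (rule bij_betwI[where g = "\<lambda>((v, b), c). (v, b, c)"]) auto
  ultimately have "bij_betw ((\<lambda>((v, b), c). v \<otimes> t [^] b \<otimes> t' [^] c) \<circ> (\<lambda>(v, b, c). ((v, b), c))) D W"
    using bij_betw_trans by blast
  then have e: "bij_betw e D W"
    by (rule bij_betw_cong[THEN iffD1, rotated]) (auto simp: e_def D_def m_assoc t vG)
  define f' where "f' = (\<lambda>(v, b, c). f v \<otimes> (t [^] c \<otimes> t' [^] (b + c))) \<circ> the_inv_into D e"
  have f'_e: "f' (e (v, b, c)) = f v \<otimes> (t [^] c \<otimes> t' [^] (b + c))" if "(v, b, c) \<in> D" for v b c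
    using e that by (simp add: f'_def bij_betw_def the_inv_into_f_f)
  have f'_mult1: "f' (e (v, b, c)) \<otimes> e (v, b, c)
      = (f v \<otimes> v) \<otimes> (t [^] (b + c) \<otimes> t' [^] (b + c + c))" if "(v, b, c) \<in> D" for v b c
    unfolding f'_e[OF that] using that fG vG t by (simp add: e_def D_def m_ac nat_pow_mult[symmetric])
  have f'_mult2: "f' (e (v, b, c)) \<otimes> f' (e (v, b, c)) \<otimes> e (v, b, c)
      = (f v \<otimes> f v \<otimes> v) \<otimes> (t [^] (b + c + c) \<otimes> t' [^] (b + b + c + c + c))" if "(v, b, c) \<in> D" for v b c
    unfolding f'_e[OF that] using that fG vG t by (simp add: e_def D_def m_ac nat_pow_mult[symmetric])
  have inj_on_W: "inj_on F W" if "inj_on (F \<circ> e) D" for F :: "'a \<Rightarrow> 'a"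
    using that e by (metis bij_betw_def inj_on_imageI)
  \<comment> \<open>Common pattern of the three injectivity proofs: \<open>h\<close> acts on the
    \<open>V\<close>-part, and the exponents undergo a map that \<open>lin\<close> makes injective
    modulo \<open>p\<close>.\<close>
  have inj: "inj_on F W" if F: "\<And>v b c. (v, b, c) \<in> D \<Longrightarrow> F (e (v, b, c)) = h v \<otimes> (t [^] i b c \<otimes> t' [^] j b c)"
    and h: "h ` V \<subseteq> V" "inj_on h V"
    and lin: "\<And>b c b' c'. [i b c = i b' c'] (mod p) \<Longrightarrow> [j b c = j b' c'] (mod p) \<Longrightarrow>
       [b = b'] (mod p) \<and> [c = c'] (mod p)" for F h and i j :: "nat \<Rightarrow> nat \<Rightarrow> nat"
  proof (rule inj_on_W, rule inj_onI)
    fix x y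
    assume xy: "x \<in> D" "y \<in> D" "(F \<circ> e) x = (F \<circ> e) y"
    obtain v b c w b' c' where [simp]: "x = (v, b, c)" "y = (w, b', c')"
      by (cases x, cases y)
    have D: "(v, b, c) \<in> D" "(w, b', c') \<in> D"
      using xy by simp_all
    have eq: "h v \<otimes> (t [^] i b c \<otimes> t' [^] j b c) = h w \<otimes> (t [^] i b' c' \<otimes> t' [^] j b' c')"
      using xy(3) F[OF D(1)] F[OF D(2)] by simp
    have V': "v \<in> V" "w \<in> V" "h v \<in> V" "h w \<in> V"
      using D h(1) by (auto simp: D_def)
    then have "[b = b'] (mod p) \<and> [c = c'] (mod p)"
      using lin independent_cong[OF V t ind \<open>0 < p\<close> V'(3,4) eq] by blast
    then have bc: "b = b'" "c = c'"
      using D cong_less_modulus_unique_nat by (auto simp: D_def)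
    then have "h v = h w"
      using eq vG[OF V'(3)] vG[OF V'(4)] t by simp
    then show "x = y"
      using bc inj_onD[OF h(2)] V' by simp
  qed
  have "strong_map W f'"
    unfolding strong_map_def
  proof (intro conjI)
    show "f' ` W \<subseteq> W"
    proof -
      have "f' x \<in> W" if "x \<in> W" for x
      proof -
        obtain v b c where x: "x = e (v, b, c)" "(v, b, c) \<in> D"
        proof -
          have "x \<in> e ` D"
            using \<open>x \<in> W\<close> e by (simp add: bij_betw_def)
          then show ?thesis
            using that by (metis imageE prod_cases3)
        qed
        have "f' x = (f v \<otimes> t [^] c) \<otimes> t' [^] (b + c)"
          using x fG t by (simp add: f'_e D_def m_assoc)
        then show ?thesis
          unfolding W_def using x fV by (auto simp: D_def intro!: adjoinI)
      qed
      then show ?thesis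
        by blast
    qed
    show "inj_on f' W"
    proof (rule inj[where h = f and i = "\<lambda>b c. c" and j = "\<lambda>b c. b + c", OF f'_e])
      fix b c b' c' assume 1: "[c = c'] (mod p)" and 2: "[b + c = b' + c'] (mod p)"
      have "[b + c = b' + c] (mod p)"
        using 1 2 by (meson cong_add_lcancel_nat cong_sym cong_trans)
      then show "[b = b'] (mod p) \<and> [c = c'] (mod p)"
        using 1 by (simp add: cong_add_rcancel_nat)
    qed (use f in \<open>auto simp: strong_map_def\<close>)
    show "inj_on (\<lambda>x. f' x \<otimes> x) W"
    proof (rule inj[where h = "\<lambda>v. f v \<otimes> v" and i = "\<lambda>b c. b + c" and j = "\<lambda>b c. b + c + c", OF f'_mult1])
      fix b c b' c' assume 1: "[b + c = b' + c'] (mod p)" and 2: "[b + c + c = b' + c' + c'] (mod p)"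
      have "[b + c + c = b + c + c'] (mod p)"
        using 1 2 by (meson cong_add_rcancel_nat cong_sym cong_trans)
      then have 3: "[c = c'] (mod p)"
        by (simp add: cong_add_lcancel_nat)
      then have "[b + c = b' + c] (mod p)"
        using 1 by (meson cong_add_lcancel_nat cong_sym cong_trans)
      then show "[b = b'] (mod p) \<and> [c = c'] (mod p)"
        using 3 by (simp add: cong_add_rcancel_nat)
    next
      show "inj_on (\<lambda>v. f v \<otimes> v) V"
        using f by (simp add: strong_map_def)
    qed (use fV sub_mult[OF V] in auto)
    show "inj_on (\<lambda>x. f' x \<otimes> f' x \<otimes> x) W"
    proof (rule inj[where h = "\<lambda>v. f v \<otimes> f v \<otimes> v" and i = "\<lambda>b c. b + c + c"
          and j = "\<lambda>b c. b + b + c + c + c", OF f'_mult2])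
      fix b c b' c' assume 1: "[b + c + c = b' + c' + c'] (mod p)"
        and 2: "[b + b + c + c + c = b' + b' + c' + c' + c'] (mod p)"
      \<comment> \<open>Elimination: \<open>2 b + 3 c\<close> minus \<open>b + 2 c\<close> leaves
        \<open>b + c\<close>, and \<open>b + 2 c\<close> minus that leaves \<open>c\<close>.\<close>
      have "[(b + c + c) + (b + c) = (b' + c' + c') + (b' + c')] (mod p)"
        using 2 by (simp add: algebra_simps)
      moreover have "[(b' + c' + c') + (b + c) = (b + c + c) + (b + c)] (mod p)"
        using 1 by (simp add: cong_add_rcancel_nat cong_sym)
      ultimately have 3: "[b + c = b' + c'] (mod p)"
        by (meson cong_add_lcancel_nat cong_trans)
      have "[b + c + c = b + c + c'] (mod p)"
        using 1 3 by (meson cong_add_rcancel_nat cong_sym cong_trans)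
      then have 4: "[c = c'] (mod p)"
        by (simp add: cong_add_lcancel_nat)
      then have "[b + c = b' + c] (mod p)"
        using 3 by (meson cong_add_lcancel_nat cong_sym cong_trans)
      then show "[b = b'] (mod p) \<and> [c = c'] (mod p)"
        using 4 by (simp add: cong_add_rcancel_nat)
    next
      show "inj_on (\<lambda>v. f v \<otimes> f v \<otimes> v) V"
        using f by (simp add: strong_map_def)
    qed (use fV sub_mult[OF V] in auto)
  qed
  then show ?thesis
    unfolding W_def by blast
qed

text \<open>The harmonious sequence is extended by one generator at a time, the strong map by both
  at once. The growth in cardinality will contradict a maximal choice of \<open>V\<close>.\<close>

lemma good_adjoin:
  assumes "good V" and t: "t \<in> carrier G" "t' \<in> carrier G"
    and ind: "independent V p t t'" and p: "odd p" "1 < p"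
  shows "good (adjoin (adjoin V t) t')" and "card V < card (adjoin (adjoin V t) t')"
proof -
  obtain u f where V: "subgroup V G" "odd (card V)" and u: "harmonious V u" and f: "strong_map V f"
    using \<open>good V\<close> unfolding good_def by blast
  have "0 < p"
    using p by simp
  note o = independent_rel_order[OF V(1) t ind this]
  have W: "subgroup (adjoin V t) G" "card (adjoin V t) = p * card V"
    using sub_adjoin[OF V(1) t(1)] card_adjoin[OF V(1) t(1) o(1)] by auto
  have X: "subgroup (adjoin (adjoin V t) t') G"
    "card (adjoin (adjoin V t) t') = p * (p * card V)"
    using sub_adjoin[OF W(1) t(2)] card_adjoin[OF W(1) t(2) o(2)] W(2) by auto
  obtain u' where "harmonious (adjoin V t) u'"
    using harmonious_adjoin[OF V u t(1) o(1) p(1)] by blast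
  then have "\<exists>u. harmonious (adjoin (adjoin V t) t') u"
    using harmonious_adjoin[OF W(1) _ _ t(2) o(2) p(1)] W(2) V(2) p(1) by simp
  then show "good (adjoin (adjoin V t) t')"
    using X V(2) p(1) strong_map_adjoin[OF V(1) f t ind \<open>0 < p\<close>] by (simp add: good_def)
  show "card V < card (adjoin (adjoin V t) t')"
    using X(2) p(2) sub_card_pos[OF V(1)] by (simp add: one_less_mult mult.assoc[symmetric])
qed

lemma good_trivial: "good {\<one>}"
proof -
  have "harmonious {\<one>} (\<lambda>_. \<one>)" "strong_map {\<one>} (\<lambda>_. \<one>)"
    by (auto simp: harmonious_def strong_map_def)
  then show ?thesis
    by (auto simp: good_def triv_subgroup)
qed

section \<open>A good subgroup with cyclic quotient\<close>

lemma coprime_pow_mem: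
  assumes W: "subgroup W G" and y: "y \<in> carrier G"
    and "y [^] (a::nat) \<in> W" "y [^] (b::nat) \<in> W" "coprime a b"
  shows "y \<in> W"
proof -
  obtain N where N: "rel_order W y N"
    using ex_rel_order[OF W y] .
  then have "N dvd a" "N dvd b"
    using assms by (auto simp: rel_order_def)
  then have "N = 1"
    using coprime_common_divisor_nat[OF \<open>coprime a b\<close>] by simp
  then have "y [^] k \<in> W" for k :: nat
    using N by (simp add: rel_order_def)
  from this[of 1] show ?thesis
    using y by simp
qed

text \<open>Take any element outside \<open>S\<close> and raise it to its relative order divided by
  a prime factor.\<close>

lemma ex_prime_pow_mem:
  assumes S: "subgroup S G" and "S \<noteq> carrier G"
  obtains y p where "y \<in> carrier G" "y \<notin> S" "Factorial_Ring.prime p" "y [^] (p::nat) \<in> S"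
proof -
  obtain x where x: "x \<in> carrier G" "x \<notin> S"
    using assms subgroup.subset by blast
  obtain M where M: "rel_order S x M"
    using ex_rel_order[OF S x(1)] .
  have "M \<noteq> 1"
  proof
    assume "M = 1"
    then have "x [^] k \<in> S" for k :: nat
      using M by (simp add: rel_order_def)
    from this[of 1] show False
      using x by simp
  qed
  then obtain p where p: "Factorial_Ring.prime p" "p dvd M"
    using prime_factor_nat by blast
  have "0 < M"
    using M by (simp add: rel_order_def)
  have "M div p < M"
    using p \<open>0 < M\<close> prime_gt_1_nat by simp
  then have "\<not> M dvd M div p"
    using \<open>0 < M\<close> p by (metis dvd_div_eq_0_iff nat_dvd_not_less neq0_conv)
  then have 1: "x [^] (M div p) \<notin> S"
    using M by (simp add: rel_order_def)
  have "x [^] M \<in> S"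
    using M by (simp add: rel_order_def)
  then have 2: "(x [^] (M div p)) [^] p \<in> S"
    using x p by (simp add: nat_pow_pow)
  show ?thesis
    by (rule that[OF _ 1 p(1) 2]) (use x in simp)
qed

text \<open>The involutions are \<open>t [^] card V\<close> and \<open>t' [^] card V\<close>. The
  odd exponent keeps them nontrivial and distinct; their squares are \<open>card V\<close>-th powers
  of elements of \<open>V\<close>.\<close>

lemma ex_two_involutions:
  assumes V: "subgroup V G" and odd: "odd (card V)"
    and t: "t \<in> carrier G" "t' \<in> carrier G" and ind: "independent V 2 t t'"
  obtains x y where "x \<in> carrier G" "y \<in> carrier G" "x \<otimes> x = \<one>" "y \<otimes> y = \<one>"
    "x \<noteq> \<one>" "y \<noteq> \<one>" "x \<noteq> y"
proof -
  let ?v = "card V"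
  note ind' = ind[unfolded independent_def, rule_format]
  have one: "\<one> \<in> V"
    using subgroup.one_closed[OF V] .
  have sq: "z [^] ?v \<otimes> z [^] ?v = \<one>" if "z \<in> carrier G" "z [^] (2::nat) \<in> V" for z
  proof -
    have "z [^] ?v \<otimes> z [^] ?v = (z [^] (2::nat)) [^] ?v"
      using that by (simp add: nat_pow_pow nat_pow_mult mult_2)
    then show ?thesis
      using pow_card_sub[OF V that(2)] by simp
  qed
  have 1: "t [^] ?v \<otimes> t [^] ?v = \<one>" "t' [^] ?v \<otimes> t' [^] ?v = \<one>"
    using sq t ind'[of 2 0] ind'[of 0 2] by auto
  have 2: "t [^] ?v \<noteq> \<one>" "t' [^] ?v \<noteq> \<one>"
    using ind'[of ?v 0] ind'[of 0 ?v] t one odd by auto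
  have 3: "t [^] ?v \<noteq> t' [^] ?v"
    using ind'[of ?v ?v] 1 one odd by auto
  show ?thesis
    by (rule that[OF _ _ 1 2 3]) (use t in auto)
qed

text \<open>Choose a good \<open>V\<close> of largest order, then \<open>d\<close> generating as
  much as possible over it. An element of prime order modulo the resulting subgroup either yields a
  better \<open>d\<close> or, with a power of \<open>d\<close>, an independent pair. For an odd
  prime such a pair enlarges \<open>V\<close>; for 2 it gives two involutions.\<close>

lemma ex_good_generator:
  assumes inv_unique: "\<And>x y. x \<in> carrier G \<Longrightarrow> y \<in> carrier G \<Longrightarrow> x \<otimes> x = \<one> \<Longrightarrow> y \<otimes> y = \<one> \<Longrightarrow>
    x \<noteq> \<one> \<Longrightarrow> y \<noteq> \<one> \<Longrightarrow> x = y"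
  obtains V d where "good V" "d \<in> carrier G" "adjoin V d = carrier G"
proof -
  have sub_less: "card V < Suc (card (carrier G))" if "subgroup V G" for V
    using that finite_carrier by (simp add: card_mono subgroup.subset less_Suc_eq_le)
  have "\<exists>V. good V \<and> (\<forall>W. good W \<longrightarrow> card W \<le> card V)"
    by (rule ex_has_greatest_nat[where P = good and f = card and b = "Suc (card (carrier G))",
          OF good_trivial])
      (use sub_less in \<open>simp add: good_def\<close>)
  then obtain V where good: "good V" and maxV: "\<And>W. good W \<Longrightarrow> card W \<le> card V"
    by blast
  have V: "subgroup V G" "odd (card V)"
    using good by (auto simp: good_def)
  have "\<exists>d. d \<in> carrier G \<and> (\<forall>c. c \<in> carrier G \<longrightarrow> card (adjoin V c) \<le> card (adjoin V d))"
    by (rule ex_has_greatest_nat[where P = "\<lambda>d. d \<in> carrier G" and f = "\<lambda>d. card (adjoin V d)"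
          and b = "Suc (card (carrier G))", OF one_closed])
      (use sub_less[OF sub_adjoin[OF V(1)]] in blast)
  then obtain d where d: "d \<in> carrier G"
    and maxd: "\<And>c. c \<in> carrier G \<Longrightarrow> card (adjoin V c) \<le> card (adjoin V d)"
    by blast
  define S where "S = adjoin V d"
  have S: "subgroup S G"
    using sub_adjoin[OF V(1) d] by (simp add: S_def)
  have VS: "v \<in> S" if "v \<in> V" for v
    using sub_adjoin_subset[OF V(1) d] that by (auto simp: S_def)
  have dS: "d [^] (k::nat) \<in> S" for k
    using gen_pow_in_adjoin[OF V(1) d] by (simp add: S_def)
  have no_bigger: "y \<in> S" if c: "c \<in> carrier G" and "d \<in> adjoin V c" "y \<in> adjoin V c" for c y
  proof -
    have "S \<subseteq> adjoin V c"
      unfolding S_def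
      by (rule adjoin_least[OF sub_adjoin[OF V(1) c] sub_adjoin_subset[OF V(1) c] that(2)])
    then have "S = adjoin V c"
      using maxd[OF c] sub_finite[OF sub_adjoin[OF V(1) c]]
      by (intro card_seteq) (auto simp: S_def)
    then show ?thesis
      using that by simp
  qed
  have "S = carrier G"
  proof (rule ccontr)
    assume "S \<noteq> carrier G"
    then obtain y p where y: "y \<in> carrier G" "y \<notin> S" and p: "Factorial_Ring.prime p" and ypS: "y [^] (p::nat) \<in> S"
      using ex_prime_pow_mem[OF S] by blast
    have p1: "1 < p"
      using p prime_gt_1_nat by blast
    obtain v and k :: nat where vk: "v \<in> V" "y [^] p = v \<otimes> d [^] k"
      using ypS unfolding S_def adjoin_def by blast
    have vG: "v \<in> carrier G"
      using vk sub_carrier[OF V(1)] by blast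
    obtain N where N: "rel_order V d N"
      using ex_rel_order[OF V(1) d] .
    show False
    proof (cases "p dvd k")
      case False
      then have k: "k \<noteq> 0" "gcd k p = 1"
        using prime_imp_coprime[OF p False] by (auto simp: coprime_iff_gcd_eq_1 gcd.commute[of k]
            intro: Nat.gr0I)
      then obtain b a where ba: "k * b = p * a + 1"
        using bezout_nat[of k p] by auto
      \<comment> \<open>By the Bezout identity, \<open>c [^] p\<close> is \<open>d\<close> up to a
        factor in \<open>V\<close>. So \<open>c\<close> recovers \<open>d\<close>, and then
        \<open>y\<close> because \<open>b\<close> is coprime to \<open>p\<close>.\<close>
      define c where "c = y [^] b \<otimes> inv (d [^] a)"
      have c: "c \<in> carrier G"
        using y d by (simp add: c_def)
      let ?C = "adjoin V c"
      have C: "subgroup ?C G"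
        using sub_adjoin[OF V(1) c] .
      have cd: "c \<otimes> d [^] a = y [^] b"
        using y d by (simp add: c_def m_assoc)
      have "c [^] p \<otimes> d [^] (p * a) = (c \<otimes> d [^] a) [^] p"
        using c d by (simp add: nat_pow_distrib nat_pow_pow mult.commute)
      also have "\<dots> = (y [^] p) [^] b"
        unfolding cd using y by (simp add: nat_pow_pow mult.commute)
      also have "\<dots> = v [^] b \<otimes> d [^] (k * b)"
        unfolding vk using vG d by (simp add: nat_pow_distrib nat_pow_pow)
      also have "\<dots> = (v [^] b \<otimes> d) \<otimes> d [^] (p * a)"
        unfolding ba using vG d by (simp add: m_ac)
      finally have "c [^] p = v [^] b \<otimes> d"
        using c d vG by simp
      moreover have VC: "v [^] i \<in> ?C" for i :: nat
        using sub_pow[OF V(1) vk(1)] sub_adjoin_subset[OF V(1) c] by blast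
      ultimately have dC: "d \<in> ?C"
        using sub_cancel[OF C VC d] gen_pow_in_adjoin[OF V(1) c] by metis
      have "y [^] b \<in> ?C"
        unfolding cd[symmetric] using dC gen_in_adjoin[OF V(1) c] C sub_mult sub_pow by blast
      moreover have "y [^] p \<in> ?C"
        unfolding vk using VC[of 1] vG dC C by (auto intro: sub_mult sub_pow)
      moreover have "coprime b p"
      proof (rule coprimeI)
        fix e assume e: "e dvd b" "e dvd p"
        then have "e dvd p * a + 1"
          using ba by (metis dvd_mult)
        then show "is_unit e"
          using e(2) by (metis dvd_add_right_iff dvd_mult2)
      qed
      ultimately have "y \<in> ?C"
        using coprime_pow_mem[OF C y(1)] by blast
      then show False
        using no_bigger[OF c dC] y by blast
    next
      case True
      then obtain l where l: "k = p * l"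
        by blast
      \<comment> \<open>Correcting \<open>y\<close> by a power of \<open>d\<close> brings its
        \<open>p\<close>-th power into \<open>V\<close> itself.\<close>
      define w where "w = y \<otimes> inv (d [^] l)"
      have w: "w \<in> carrier G"
        using y d by (simp add: w_def)
      have wd: "w \<otimes> d [^] l = y"
        using y d by (simp add: w_def m_assoc)
      have wS: "w \<notin> S"
        using y wd dS sub_mult[OF S] by metis
      have "w [^] p \<otimes> d [^] k = (w \<otimes> d [^] l) [^] p"
        using w d by (simp add: nat_pow_distrib nat_pow_pow mult.commute l)
      also have "\<dots> = v \<otimes> d [^] k"
        unfolding wd vk ..
      finally have wp: "w [^] p = v"
        using w d vG by simp
      show False
      proof (cases "p dvd N")
        case False
        then have "coprime p N"
          using p prime_imp_coprime by blast
        \<comment> \<open>The orders of \<open>w\<close> and \<open>d\<close> modulo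
          \<open>V\<close> are \<open>p\<close> and \<open>N\<close>, here coprime, so the product
          generates both.\<close>
        define c where "c = w \<otimes> d"
        have c: "c \<in> carrier G"
          using w d by (simp add: c_def)
        let ?C = "adjoin V c"
        have C: "subgroup ?C G"
          using sub_adjoin[OF V(1) c] .
        have VC: "V \<subseteq> ?C"
          using sub_adjoin_subset[OF V(1) c] .
        have "v \<otimes> d [^] p = c [^] p"
          using w d wp by (simp add: c_def nat_pow_distrib)
        then have "d [^] p \<in> ?C"
          using sub_cancel[OF C, of v] VC vk(1) d gen_pow_in_adjoin[OF V(1) c] by auto
        moreover have "d [^] N \<in> ?C"
          using N VC by (auto simp: rel_order_def)
        ultimately have dC: "d \<in> ?C"
          using coprime_pow_mem[OF C d] \<open>coprime p N\<close> by blast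
        moreover have "d \<otimes> w \<in> ?C"
          using gen_in_adjoin[OF V(1) c] w d by (simp add: c_def m_comm)
        ultimately have "w \<in> ?C"
          using sub_cancel[OF C dC w] by blast
        then show False
          using no_bigger[OF c dC] wS by blast
      next
        case True
        then obtain q where q: "N = p * q"
          by blast
        \<comment> \<open>This has order \<open>p\<close> modulo \<open>V\<close>, and
          \<open>w\<close> is independent of it because \<open>w\<close> lies outside
          \<open>S\<close>.\<close>
        define t where "t = d [^] q"
        have t: "t \<in> carrier G"
          using d by (simp add: t_def)
        have tV: "t [^] i \<in> V \<longleftrightarrow> p dvd i" for i :: nat
          using N d by (auto simp: t_def nat_pow_pow rel_order_def q mult.commute[of p])
        have wV: "w [^] j \<in> V" if "p dvd j" for j :: nat
          using that w wp sub_pow[OF V(1) vk(1)] by (auto simp: nat_pow_pow[symmetric])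
        have wj: "p dvd j" if "w [^] j \<in> S" for j :: nat
        proof (rule ccontr)
          assume "\<not> p dvd j"
          then have "coprime p j"
            using p prime_imp_coprime by blast
          then show False
            using coprime_pow_mem[OF S w _ that] wV[of p] VS wS by auto
        qed
        have "independent V p t w"
          unfolding independent_def
        proof (intro allI iffI)
          fix i j :: nat assume tw: "t [^] i \<otimes> w [^] j \<in> V"
          have "t [^] i \<in> S"
            using d dS by (simp add: t_def nat_pow_pow)
          then have "w [^] j \<in> S"
            using sub_cancel[OF S _ _ VS[OF tw]] w by blast
          then have j: "p dvd j"
            by (rule wj)
          have "w [^] j \<otimes> t [^] i \<in> V"
            using tw t w by (simp add: m_comm)
          then have "t [^] i \<in> V"
            using sub_cancel[OF V(1) wV[OF j]] t by blast
          then show "p dvd i \<and> p dvd j"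
            using tV j by simp
        next
          fix i j :: nat assume "p dvd i \<and> p dvd j"
          then show "t [^] i \<otimes> w [^] j \<in> V"
            using sub_mult[OF V(1)] tV wV by simp
        qed
        show False
        proof (cases "p = 2")
          case True
          then show False
            using ex_two_involutions[OF V t w] \<open>independent V p t w\<close> inv_unique by metis
        next
          case False
          then have "odd p"
            using p p1 by (metis prime_odd_nat le_neq_implies_less Suc_1 Suc_leI One_nat_def)
          then show False
            using good_adjoin[OF good t w \<open>independent V p t w\<close> _ p1] maxV by (meson leD)
        qed
      qed
    qed
  qed
  then show ?thesis
    using that good d by (simp add: S_def)
qed

end

section \<open>Partial transversals and colourings\<close>

lemma partial_transversal_subset:
  "partial_transversal n L T \<Longrightarrow> T' \<subseteq> T \<Longrightarrow> partial_transversal n L T'"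
  unfolding partial_transversal_def by (blast intro: inj_on_subset)

text \<open>Overlaps do no harm: assign each cell to one covering set and take the fibres of the
  assignment.\<close>

lemma chromatic_number_le_card_cover:
  assumes F: "finite F" "\<And>T. T \<in> F \<Longrightarrow> partial_transversal n L T" and cover: "cells n \<subseteq> \<Union>F"
  shows "chromatic_number n L \<le> card F"
proof -
  define f where "f c = (SOME T. T \<in> F \<and> c \<in> T)" for c
  have f: "f c \<in> F \<and> c \<in> f c" if "c \<in> cells n" for c
    unfolding f_def by (rule someI_ex) (use cover that in blast)
  define P where "P = (\<lambda>T. {c \<in> cells n. f c = T}) ` f ` cells n"
  have "partition_on (cells n) P"
    unfolding P_def by (rule partition_onI) (auto simp: disjnt_def)
  moreover have "partial_transversal n L T" if TP: "T \<in> P" for T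
  proof -
    obtain c where c: "c \<in> cells n" and T: "T = {c' \<in> cells n. f c' = f c}"
      using TP unfolding P_def by blast
    have "T \<subseteq> f c"
      using f by (auto simp: T)
    then show ?thesis
      using partial_transversal_subset[OF F(2)] f[OF c] by blast
  qed
  ultimately have "chromatic_number n L \<le> card P"
    unfolding chromatic_number_def by (intro Least_le exI[of _ P]) simp
  also have "\<dots> \<le> card (f ` cells n)"
    unfolding P_def by (rule card_image_le) (simp add: cells_def)
  also have "\<dots> \<le> card F"
    using f F(1) by (intro card_mono) auto
  finally show ?thesis .
qed

definition group_transversal :: "('a, 'b) monoid_scheme \<Rightarrow> ('a \<times> 'a) set \<Rightarrow> bool" where
  "group_transversal G T \<longleftrightarrow> T \<subseteq> carrier G \<times> carrier G \<and>
     inj_on fst T \<and> inj_on snd T \<and> inj_on (\<lambda>(x, y). x \<otimes>\<^bsub>G\<^esub> y) T"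

lemma chromatic_number_cayley_table_le:
  assumes g: "bij_betw g {..<n} (carrier G)"
    and F: "finite F" "\<And>T. T \<in> F \<Longrightarrow> group_transversal G T"
    and cover: "carrier G \<times> carrier G \<subseteq> \<Union>F"
  shows "chromatic_number n (cayley_table G g) \<le> card F"
proof -
  define pull where "pull T = {(i, j) \<in> cells n. (g i, g j) \<in> T}" for T
  have inj: "i = j" if "i < n" "j < n" "g i = g j" for i j
    using that g by (auto simp: bij_betw_def inj_on_def)
  have "partial_transversal n (cayley_table G g) (pull T)" if "T \<in> F" for T
  proof -
    note T = F(2)[OF that, unfolded group_transversal_def]
    have key: "p = q" if pq: "p \<in> pull T" "q \<in> pull T"
      and "fst p = fst q \<or> snd p = snd q \<or> g (fst p) \<otimes>\<^bsub>G\<^esub> g (snd p) = g (fst q) \<otimes>\<^bsub>G\<^esub> g (snd q)"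
    for p q
    proof -
      define h where "h = map_prod g g"
      have h: "h p \<in> T" "h q \<in> T"
        using pq by (auto simp: pull_def h_def)
      have "fst (h p) = fst (h q) \<or> snd (h p) = snd (h q) \<or>
          (\<lambda>(x, y). x \<otimes>\<^bsub>G\<^esub> y) (h p) = (\<lambda>(x, y). x \<otimes>\<^bsub>G\<^esub> y) (h q)"
        using that(3) by (auto simp: h_def split_beta)
      then have "h p = h q"
        using T inj_onD[OF _ _ h] by blast
      then show "p = q"
        using pq inj by (auto simp: pull_def cells_def h_def)
    qed
    then show ?thesis
      unfolding partial_transversal_def cayley_table_def
    proof (intro conjI inj_onI)
      show "pull T \<subseteq> cells n"
        by (auto simp: pull_def)
    qed (erule (1) key; simp add: split_beta)+
  qed
  moreover have "cells n \<subseteq> \<Union>(pull ` F)"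
  proof
    fix c assume c: "c \<in> cells n"
    obtain i j where ij: "c = (i, j)"
      by fastforce
    have "(g i, g j) \<in> carrier G \<times> carrier G"
      using c g by (auto simp: ij cells_def bij_betw_def)
    then show "c \<in> \<Union>(pull ` F)"
      using cover c by (auto simp: ij pull_def)
  qed
  ultimately have "chromatic_number n (cayley_table G g) \<le> card (pull ` F)"
    using F(1) by (intro chromatic_number_le_card_cover) auto
  also have "\<dots> \<le> card F"
    using F(1) by (rule card_image_le)
  finally show ?thesis .
qed

lemma group_transversal_image:
  assumes "\<And>x. x \<in> D \<Longrightarrow> r x \<in> carrier G" "\<And>x. x \<in> D \<Longrightarrow> c x \<in> carrier G"
    and "inj_on r D" "inj_on c D" "inj_on (\<lambda>x. r x \<otimes>\<^bsub>G\<^esub> c x) D"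
  shows "group_transversal G ((\<lambda>x. (r x, c x)) ` D)"
  using assms unfolding group_transversal_def inj_on_def by (auto; blast)

section \<open>A partial transversal of a cyclic group of even order\<close>

text \<open>
  For \<open>j < m\<close>, the cell of the addition table of \<open>\<int>/2m\<close> in row \<open>row_exp m j\<close> whose column minus row is
  \<open>2 j + (j mod 2)\<close>. In terms of \<open>l = j div 2\<close>, the rows, columns and symbols are affine in \<open>l\<close> with
  slopes -1, 3 and 2 on each parity class. The offset depending on \<open>3 dvd m\<close> separates
  the columns of the two classes; the rows for odd \<open>j\<close> stay below \<open>m - 1\<close>, where the step of the
  enumeration of the group is multiplication by the generator.
\<close>

definition row_exp :: "nat \<Rightarrow> nat \<Rightarrow> nat" where
  "row_exp m j = (if even j then 2 * m - 1 - j div 2 - (if 3 dvd m then 0 else 1)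
     else m - 2 - j div 2)"

lemma cong_cases_nat:
  fixes a b N :: nat
  assumes "[a = b] (mod N)" "a < b + 2 * N" "b < a + 2 * N"
  shows "a = b \<or> a = b + N \<or> b = a + N"
proof -
  have *: "b = a \<or> b = a + N" if "a \<le> b" "[a = b] (mod N)" "b < a + 2 * N" for a b :: nat
  proof -
    have "N dvd b - a"
      using that by (metis cong_sym cong_altdef_nat)
    then obtain k where k: "b - a = N * k" ..
    then have "N * k < N * 2"
      using that by linarith
    then have "k < 2"
      by simp
    then show ?thesis
      using k \<open>a \<le> b\<close> by (auto simp: less_2_cases_iff)
  qed
  show ?thesis
    using *[of a b] *[of b a] assms cong_sym[OF assms(1)] by (cases "a \<le> b") auto
qed

text \<open>Here \<open>x\<close> and \<open>y\<close> are the column exponents for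
  \<open>j = 2 a\<close> and \<open>j = 2 b + 1\<close>. Reduction modulo 3 excludes every
  coincidence except \<open>y = x + 2 * m\<close> when 3 does not divide \<open>m\<close>; that one
  is impossible by size, since \<open>2 * b + 1 < m\<close>.\<close>

lemma column_exp_parity:
  fixes m x y a b e :: nat
  assumes x: "x + 1 + e = 2 * m + 3 * a" and y: "y = m + 3 * b + 1" and b: "2 * b + 1 < m"
    and m: "(m mod 3 = 0 \<and> e = 0) \<or> (m mod 3 \<noteq> 0 \<and> e = 1)"
    and xy: "x = y \<or> x = y + 2 * m \<or> y = x + 2 * m"
  shows False
proof -
  have A: "m + 3 * a = 3 * b + 2 + e \<or> 3 * a = m + 3 * b + 2 + e \<or> 3 * m + 3 * a = 3 * b + 2 + e"
    using x y xy by linarith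
  define r s where "r = m div 3" and "s = m mod 3"
  have r: "m = 3 * r + s" and "s < 3"
    by (simp_all add: r_def s_def)
  have "s = 0 \<or> s = 1 \<or> s = 2"
    using \<open>s < 3\<close> by linarith
  moreover have "s = 0 \<and> e = 0 \<or> s \<noteq> 0 \<and> e = 1"
    using m unfolding s_def .
  ultimately consider "s = 0" "e = 0" | "s = 1" "e = 1" | "s = 2" "e = 1"
    by auto
  moreover have no: "3 * p \<noteq> 3 * q + 1" "3 * p \<noteq> 3 * q + 2" for p q :: nat
    by presburger+
  ultimately show False
  proof cases
    case 1
    then show False
      using A r no(2)[of "r + a" b] no(2)[of a "r + b"] no(2)[of "3 * r + a" b] by simp
  next
    case 2
    show False
      using A
    proof (elim disjE)
      assume "m + 3 * a = 3 * b + 2 + e"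
      then have "3 * (r + a) = 3 * b + 2"
        using r 2 by simp
      then show False
        using no by blast
    next
      assume "3 * a = m + 3 * b + 2 + e"
      then have "3 * a = 3 * (r + b + 1) + 1"
        using r 2 by simp
      then show False
        using no by blast
    next
      assume "3 * m + 3 * a = 3 * b + 2 + e"
      then show False
        using r b 2 by linarith
    qed
  next
    case 3
    show False
      using A
    proof (elim disjE)
      assume "m + 3 * a = 3 * b + 2 + e"
      then have "3 * (r + a) = 3 * b + 1"
        using r 3 by simp
      then show False
        using no by blast
    next
      assume "3 * a = m + 3 * b + 2 + e"
      then have "3 * a = 3 * (r + b + 1) + 2"
        using r 3 by simp
      then show False
        using no by blast
    next
      assume "3 * m + 3 * a = 3 * b + 2 + e"
      then show False
        using r b 3 by linarith
    qed
  qed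
qed

text \<open>Within a parity class the columns have slope 3 and spread over less than
  \<open>3 m / 2\<close>, so no wraparound by \<open>2 * m\<close> occurs;
  \<open>column_exp_parity\<close> separates the classes.\<close>

lemma column_exp_unique:
  fixes j k m x y l l' e :: nat
  assumes x: "j = 2 * l \<and> x + 1 + e = 2 * m + 3 * l \<or> j = 2 * l + 1 \<and> x = m + 3 * l + 1"
    and y: "k = 2 * l' \<and> y + 1 + e = 2 * m + 3 * l' \<or> k = 2 * l' + 1 \<and> y = m + 3 * l' + 1"
    and mod3: "(m mod 3 = 0 \<and> e = 0) \<or> (m mod 3 \<noteq> 0 \<and> e = 1)"
    and xy: "x = y \<or> x = y + 2 * m \<or> y = x + 2 * m" and less: "j < m" "k < m"
  shows "j = k"
  using x
proof (elim disjE conjE)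
  assume j: "j = 2 * l" "x + 1 + e = 2 * m + 3 * l"
  show ?thesis
    using y
  proof (elim disjE conjE)
    assume "k = 2 * l'" "y + 1 + e = 2 * m + 3 * l'"
    then show ?thesis
      using j xy less by linarith
  next
    assume k: "k = 2 * l' + 1" "y = m + 3 * l' + 1"
    show ?thesis
      using column_exp_parity[OF j(2) k(2) _ mod3 xy] k(1) less by blast
  qed
next
  assume j: "j = 2 * l + 1" "x = m + 3 * l + 1"
  have yx: "y = x \<or> y = x + 2 * m \<or> x = y + 2 * m"
    using xy by blast
  show ?thesis
    using y
  proof (elim disjE conjE)
    assume k: "k = 2 * l'" "y + 1 + e = 2 * m + 3 * l'"
    show ?thesis
      using column_exp_parity[OF k(2) j(2) _ mod3 yx] j(1) less by blast
  next
    assume "k = 2 * l' + 1" "y = m + 3 * l' + 1"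
    then show ?thesis
      using j xy less by linarith
  qed
qed

text \<open>Symbols have the parity of \<open>j\<close>, which the even modulus respects; within a
  class they spread over less than \<open>m\<close>.\<close>

lemma symbol_exp_unique:
  fixes j k m x y l l' e :: nat
  assumes x: "j = 2 * l \<and> x + 2 + 2 * e = 4 * m + 2 * l \<or> j = 2 * l + 1 \<and> x + 1 = 2 * m + 2 * l"
    and y: "k = 2 * l' \<and> y + 2 + 2 * e = 4 * m + 2 * l' \<or> k = 2 * l' + 1 \<and> y + 1 = 2 * m + 2 * l'"
    and "x = y \<or> x = y + 2 * m \<or> y = x + 2 * m" "j < m" "k < m"
  shows "j = k"
proof -
  have xy: "even x \<longleftrightarrow> even y"
    using assms(3) by auto
  have even: "even z" if "z + 2 + 2 * e = 4 * m + 2 * i" for z i :: nat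
  proof -
    have "even (z + 2 + 2 * e)"
      unfolding that by simp
    then show ?thesis
      by simp
  qed
  have odd: "odd z" if "z + 1 = 2 * m + 2 * i" for z i :: nat
  proof -
    have "even (z + 1)"
      unfolding that by simp
    then show ?thesis
      by simp
  qed
  show ?thesis
    using x
  proof (elim disjE conjE)
    assume j: "j = 2 * l" "x + 2 + 2 * e = 4 * m + 2 * l"
    then have "k = 2 * l' \<and> y + 2 + 2 * e = 4 * m + 2 * l'"
      using y xy even odd by blast
    then show ?thesis
      using j assms(3-) by linarith
  next
    assume j: "j = 2 * l + 1" "x + 1 = 2 * m + 2 * l"
    then have "k = 2 * l' + 1 \<and> y + 1 = 2 * m + 2 * l'"
      using y xy even odd by blast
    then show ?thesis
      using j assms(3-) by linarith
  qed
qed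
lemma row_exp_inj:
  assumes "j < m" "k < m"
  shows "[row_exp m j = row_exp m k] (mod 2 * m) \<Longrightarrow> j = k"
    and "[row_exp m j + (j mod 2 + 2 * j) = row_exp m k + (k mod 2 + 2 * k)] (mod 2 * m) \<Longrightarrow> j = k"
    and "[2 * row_exp m j + (j mod 2 + 2 * j) = 2 * row_exp m k + (k mod 2 + 2 * k)] (mod 2 * m) \<Longrightarrow> j = k"
proof -
  define \<epsilon> :: nat where "\<epsilon> = (if 3 dvd m then 0 else 1)"
  have mod3: "(m mod 3 = 0 \<and> \<epsilon> = 0) \<or> (m mod 3 \<noteq> 0 \<and> \<epsilon> = 1)"
    by (simp add: \<epsilon>_def dvd_eq_mod_eq_0)
  \<comment> \<open>An additive form of \<open>row_exp\<close>, free of truncated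
    subtraction.\<close>
  have e: "\<exists>l. i = 2 * l \<and> row_exp m i + 1 + l + \<epsilon> = 2 * m \<and> i mod 2 = 0 \<or>
      i = 2 * l + 1 \<and> row_exp m i + 2 + l = m \<and> i mod 2 = 1" if "i < m" for i
  proof (cases "even i")
    case True
    then obtain l where "i = 2 * l" ..
    then show ?thesis
      using that by (intro exI[of _ l]) (simp add: row_exp_def \<epsilon>_def)
  next
    case False
    then obtain l where "i = 2 * l + 1" ..
    then show ?thesis
      using that by (intro exI[of _ l]) (simp add: row_exp_def)
  qed
  obtain l where l: "j = 2 * l \<and> row_exp m j + 1 + l + \<epsilon> = 2 * m \<and> j mod 2 = 0 \<or>
      j = 2 * l + 1 \<and> row_exp m j + 2 + l = m \<and> j mod 2 = 1"
    by (rule exE[OF e[OF assms(1)]])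
  obtain l' where l': "k = 2 * l' \<and> row_exp m k + 1 + l' + \<epsilon> = 2 * m \<and> k mod 2 = 0 \<or>
      k = 2 * l' + 1 \<and> row_exp m k + 2 + l' = m \<and> k mod 2 = 1"
    by (rule exE[OF e[OF assms(2)]])
  have "\<epsilon> \<le> 1"
    by (simp add: \<epsilon>_def)
  show "j = k" if "[row_exp m j = row_exp m k] (mod 2 * m)"
  proof -
    have "row_exp m j < 2 * m" "row_exp m k < 2 * m"
      using l l' by auto
    then have "row_exp m j = row_exp m k"
      using cong_less_modulus_unique_nat[OF that] by blast
    \<comment> \<open>Rows for even \<open>j\<close> are at least \<open>m - 1\<close>, those for
      odd \<open>j\<close> at most \<open>m - 2\<close>.\<close>
    then show ?thesis
      using l l' assms \<open>\<epsilon> \<le> 1\<close> by (elim disjE conjE) linarith+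
  qed
  show "j = k" if "[row_exp m j + (j mod 2 + 2 * j) = row_exp m k + (k mod 2 + 2 * k)] (mod 2 * m)"
  proof -
    define x y where "x = row_exp m j + (j mod 2 + 2 * j)" and "y = row_exp m k + (k mod 2 + 2 * k)"
    have x: "j = 2 * l \<and> x + 1 + \<epsilon> = 2 * m + 3 * l \<or> j = 2 * l + 1 \<and> x = m + 3 * l + 1"
      using l unfolding x_def by (elim disjE conjE) simp_all
    have y: "k = 2 * l' \<and> y + 1 + \<epsilon> = 2 * m + 3 * l' \<or> k = 2 * l' + 1 \<and> y = m + 3 * l' + 1"
      using l' unfolding y_def by (elim disjE conjE) simp_all
    have "x < 4 * m"
      using x assms(1) by auto
    moreover have "y < 4 * m"
      using y assms(2) by auto
    ultimately have "x = y \<or> x = y + 2 * m \<or> y = x + 2 * m"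
      using that[folded x_def y_def] by (intro cong_cases_nat) auto
    then show ?thesis
      using column_exp_unique[OF x y mod3] assms by blast
  qed
  show "j = k" if "[2 * row_exp m j + (j mod 2 + 2 * j) = 2 * row_exp m k + (k mod 2 + 2 * k)] (mod 2 * m)"
  proof -
    define x y where "x = 2 * row_exp m j + (j mod 2 + 2 * j)" and "y = 2 * row_exp m k + (k mod 2 + 2 * k)"
    have x: "j = 2 * l \<and> x + 2 + 2 * \<epsilon> = 4 * m + 2 * l \<or> j = 2 * l + 1 \<and> x + 1 = 2 * m + 2 * l"
      using l unfolding x_def by (elim disjE conjE) simp_all
    have y: "k = 2 * l' \<and> y + 2 + 2 * \<epsilon> = 4 * m + 2 * l' \<or> k = 2 * l' + 1 \<and> y + 1 = 2 * m + 2 * l'"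
      using l' unfolding y_def by (elim disjE conjE) simp_all
    have "x + 1 < 5 * m \<and> m \<le> x + 1"
      using x assms(1) \<open>\<epsilon> \<le> 1\<close> by auto
    moreover have "y + 1 < 5 * m \<and> m \<le> y + 1"
      using y assms(2) \<open>\<epsilon> \<le> 1\<close> by auto
    ultimately have "x = y \<or> x = y + 2 * m \<or> y = x + 2 * m"
      using that[folded x_def y_def] by (intro cong_cases_nat) auto
    then show ?thesis
      using symbol_exp_unique[OF x y] assms by blast
  qed
qed

section \<open>Moebius ladders\<close>

text \<open>
  Position \<open>q\<close> of a ladder with \<open>2 n\<close> cells, from which positions 0 and \<open>n\<close> are removed.
\<close>

definition rung_colour :: "nat \<Rightarrow> nat \<Rightarrow> nat" where
  "rung_colour n q = (if q < n then q else Suc q) mod 2"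

text \<open>Colours alternate along each of the two arcs left after the removal. The flip beyond
  \<open>n\<close> gives antipodal positions, which have equal parity for even \<open>n\<close>,
  different colours.\<close>

lemma rung_colour_proper:
  assumes "even n" "1 \<le> q" "q \<le> q'" "q' < 2 * n" "q \<noteq> n" "q' \<noteq> n"
    and "rung_colour n q = rung_colour n q'" "q' \<le> q + 1 \<or> q' = q + n"
  shows "q = q'"
proof (rule ccontr)
  assume "q \<noteq> q'"
  then have cases: "q' = Suc q \<or> q' = q + n"
    using assms(3,8) by linarith
  have parity: "(if q < n then even q else odd q) \<longleftrightarrow> (if q' < n then even q' else odd q')"
    using assms(7) by (simp add: rung_colour_def split: if_splits) (simp_all add: mod2_eq_if split: if_splits)
  have "q' = Suc q \<Longrightarrow> q < n \<longleftrightarrow> q' < n"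
    using assms(5,6) by linarith
  moreover have "q' = q + n \<Longrightarrow> q < n \<and> \<not> q' < n"
    using assms(4) by linarith
  ultimately show False
    using cases parity \<open>even n\<close> by (metis even_Suc even_add)
qed

text \<open>Halving a position gives its row index, so a shared row or column forces neighbouring
  positions. The bound \<open>2 * n - 1\<close> keeps the halves less than \<open>n\<close>
  apart.\<close>

lemma cong_div2_close:
  fixes a b n :: nat
  assumes "a \<le> b" "b < a + (2 * n - 1)" "[a div 2 = b div 2] (mod n)"
  shows "b \<le> a + 1"
proof -
  have "a div 2 \<le> b div 2" "b div 2 - a div 2 < n"
    using assms(1,2) by (auto simp: div_le_mono) 
  moreover have "n dvd b div 2 - a div 2"
    using assms(3) calculation(1) by (metis cong_sym cong_altdef_nat)
  ultimately have "b div 2 = a div 2"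
    by (metis dvd_imp_le leD le_antisym diff_is_0_eq neq0_conv)
  then show ?thesis
    by linarith
qed

locale ladder = finite_comm_group +
  fixes V :: "'a set" and u :: "nat \<Rightarrow> 'a" and f :: "'a \<Rightarrow> 'a" and d :: 'a and m :: nat
  assumes V: "subgroup V G" and odd_V: "odd (card V)" and u: "harmonious V u"
    and f: "strong_map V f" and d: "d \<in> carrier G" and gen: "adjoin V d = carrier G"
    and ord_d: "rel_order V d (2 * m)"
begin

abbreviation (input) "v \<equiv> card V"

abbreviation (input) "n \<equiv> 2 * m * v"

lemma m_pos: "0 < m"
  using ord_d by (simp add: rel_order_def)

lemma v_pos: "0 < v"
  using sub_card_pos[OF V] .

lemma card_G: "card (carrier G) = n"
  using card_adjoin[OF V d ord_d] by (simp add: gen)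

lemma V_carrier: "x \<in> V \<Longrightarrow> x \<in> carrier G"
  using sub_carrier[OF V] .

lemma u_V: "u i \<in> V"
  using u by (auto simp: harmonious_def)

lemma u_carrier [simp]: "u i \<in> carrier G"
  using u_V V_carrier by blast

lemma u_eq_iff: "u i = u j \<longleftrightarrow> [i = j] (mod v)"
  using u by (simp add: harmonious_def)

lemma d_pow_cong: "x \<in> V \<Longrightarrow> y \<in> V \<Longrightarrow> x \<otimes> d [^] (a::nat) = y \<otimes> d [^] (b::nat) \<Longrightarrow> [a = b] (mod 2 * m)"
  using rel_order_cong[OF V d ord_d] .

lemma d_pow_n: "d [^] n = \<one>"
  using pow_order_eq_1[OF d] card_G by (simp add: order_def)

text \<open>The element \<open>d [^] (m * v)\<close> squares to the identity; multiplying row and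
  column by it will be the antipodal move on a ladder.\<close>

lemma d_pow_half: "d [^] (k * (m * v)) = (if even k then \<one> else d [^] (m * v))"
proof -
  have even: "d [^] (2 * l * (m * v)) = \<one>" for l
  proof -
    have "2 * l * (m * v) = n * l"
      by (simp add: algebra_simps)
    then have "d [^] (2 * l * (m * v)) = (d [^] n) [^] l"
      by (simp only: nat_pow_pow[OF d])
    then show ?thesis
      by (simp only: d_pow_n nat_pow_one)
  qed
  show ?thesis
  proof (cases "even k")
    case True
    then obtain l where "k = 2 * l" ..
    then show ?thesis
      using even by simp
  next
    case False
    then obtain l where "k = 2 * l + 1" ..
    then have "k * (m * v) = 2 * l * (m * v) + m * v"
      by (simp add: algebra_simps)
    then show ?thesis
      using False even[of l] d by (simp only: nat_pow_mult[symmetric] if_False) simp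
  qed
qed

section \<open>The cyclic enumeration of the group\<close>

definition E :: "nat \<Rightarrow> nat" where
  "E i = i mod m + i div m * (m * v)"

text \<open>Blocks of length \<open>m\<close> run through the first \<open>m\<close> powers of
  \<open>d\<close>, odd-numbered blocks being multiplied by the involution
  \<open>d [^] (m * v)\<close>. There are \<open>2 * v\<close> blocks; as \<open>v\<close> is odd, a
  block is determined by its term of \<open>u\<close> and its parity.\<close>

definition R :: "nat \<Rightarrow> 'a" where
  "R i = u (i div m) \<otimes> d [^] E i"

lemma R_carrier [simp]: "R i \<in> carrier G"
  using d by (simp add: R_def)

lemma R_eq: "R i = u (i div m) \<otimes> (d [^] (i mod m) \<otimes> d [^] (i div m * (m * v)))"
  using d by (simp add: R_def E_def nat_pow_mult)

lemma R_add_half: "R (i + m * v) = R i \<otimes> d [^] (m * v)"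
proof -
  have 1: "(i + m * v) div m = i div m + v" "(i + m * v) mod m = i mod m"
    using m_pos by simp_all
  have "u (i div m + v) = u (i div m)"
    by (simp add: u_eq_iff cong_def)
  moreover have "d [^] ((i div m + v) * (m * v)) = d [^] (i div m * (m * v)) \<otimes> d [^] (m * v)"
    using d_pow_half[of v] odd_V d
    by (simp only: add_mult_distrib nat_pow_mult[OF d, symmetric] if_False)
  ultimately show ?thesis
    unfolding R_eq 1 using d by (simp add: m_assoc)
qed

lemma R_inj:
  assumes "R i = R j"
  shows "[i = j] (mod n)"
proof -
  have c: "[E i = E j] (mod 2 * m)"
    using d_pow_cong[OF u_V u_V] assms unfolding R_def by blast
  then have "[E i = E j] (mod m)"
    using cong_dvd_modulus_nat dvd_triv_right by blast
  then have 1: "i mod m = j mod m"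
    by (simp add: E_def cong_def mult.left_commute)
  then have "[i div m * v * m = j div m * v * m] (mod 2 * m)"
    using c by (simp add: E_def cong_add_lcancel_nat mult_ac)
  then have "[i div m * v = j div m * v] (mod 2)"
    using m_pos by (simp add: cong_def mult_mod_left[symmetric])
  then have 2: "[i div m = j div m] (mod 2)"
    using odd_V by (simp add: cong_mult_rcancel_nat)
  then have "d [^] (i div m * (m * v)) = d [^] (j div m * (m * v))"
    unfolding d_pow_half by (metis cong_def even_iff_mod_2_eq_zero)
  then have "u (i div m) = u (j div m)"
    using assms d unfolding R_eq 1 by simp
  then have "[i div m = j div m] (mod 2 * v)"
    using 2 odd_V by (simp add: u_eq_iff coprime_cong_mult_nat)
  then have "[i = j] (mod m * (2 * v))"
    using 1 by (simp add: cong_mult_iff_nat)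
  then show ?thesis
    by (simp add: mult_ac)
qed

lemma R_cong: "[i = j] (mod n) \<Longrightarrow> R i = R j"
proof -
  have "R (i + k * n) = R i" for i k
  proof (induction k)
    case (Suc k)
    have "i + Suc k * n = i + k * n + m * v + m * v"
      by simp
    then show ?case
      using Suc d d_pow_half[of 2]
      by (simp only: R_add_half m_assoc R_carrier nat_pow_closed nat_pow_mult)
        (simp add: mult_2)
  qed simp
  then have "R i = R (i mod n)" for i
    by (metis mod_div_mult_eq)
  then show "[i = j] (mod n) \<Longrightarrow> R i = R j"
    by (metis cong_def)
qed

lemma R_surj:
  assumes "x \<in> carrier G"
  obtains i where "R i = x"
proof -
  have "inj_on R {..<n}"
    by (rule inj_onI) (use R_inj cong_less_modulus_unique_nat in blast)
  then have "R ` {..<n} = carrier G"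
    using finite_carrier card_G by (intro card_subset_eq) (auto simp: card_image)
  then show ?thesis
    using assms that by (metis imageE)
qed

text \<open>At a block boundary the exponent changes by \<open>m * v - (m - 1)\<close>, which is odd
  because \<open>v\<close> is. Consecutive elements thus lie in different cosets of the subgroup of
  index 2.\<close>

lemma E_Suc: "even (E i) \<longleftrightarrow> odd (E (Suc i))"
proof (cases "Suc (i mod m) = m")
  case True
  then have s: "Suc i mod m = 0" "Suc i div m = Suc (i div m)"
    using m_pos by (simp_all add: mod_Suc div_Suc)
  have "even m \<longleftrightarrow> odd (i mod m)"
    using True by (metis even_Suc)
  then show ?thesis
    unfolding E_def s using odd_V by auto
next
  case False
  then have s: "Suc i mod m = Suc (i mod m)" "Suc i div m = i div m"
    using m_pos by (simp_all add: mod_Suc div_Suc)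
  then show ?thesis
    unfolding E_def s by auto
qed

definition W :: "nat \<Rightarrow> 'a" where
  "W p = R (p div 2) \<otimes> R (Suc p div 2)"

text \<open>Symbols of the ladder repeat only at antipodes. Over one block, \<open>2 * m - 1\<close>
  positions have the square of a term of \<open>u\<close> as \<open>V\<close>-part, the involution
  cancelling; the next position joins two blocks and has a consecutive product of \<open>u\<close>.
  Since \<open>m - 1 + m * v\<close> is \<open>2 * m - 1\<close> modulo \<open>2 * m\<close>, the
  exponent of \<open>d\<close> always agrees with the position modulo \<open>2 * m\<close>.\<close>

lemma W_inj:
  assumes "W p = W q"
  shows "[p = q] (mod n)"
proof -
  define x e where "x p = u (p div (2 * m)) \<otimes>
        u (if Suc (p mod (2 * m)) = 2 * m then Suc (p div (2 * m)) else p div (2 * m))"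
    and "e p = (if Suc (p mod (2 * m)) = 2 * m then m - 1 + m * v else p mod (2 * m))" for p
  have xV: "x p \<in> V" and xG: "x p \<in> carrier G" for p
    using u_V sub_mult[OF V] V_carrier by (auto simp: x_def)
  have R2: "R (p div 2) = u (p div (2 * m)) \<otimes>
      (d [^] (p mod (2 * m) div 2) \<otimes> d [^] (p div (2 * m) * (m * v)))" for p
  proof -
    have "p div 2 div m = p div (2 * m)" "p div 2 mod m = p mod (2 * m) div 2"
      by (simp_all add: div_mult2_eq mod_mult2_eq)
    then show ?thesis
      by (simp add: R_eq)
  qed
  have W: "W p = x p \<otimes> d [^] e p" for p
  proof (cases "Suc (p mod (2 * m)) = 2 * m")
    case True
    let ?a = "p div (2 * m)"
    have s: "Suc p mod (2 * m) = 0" "Suc p div (2 * m) = Suc ?a"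
      using True m_pos by (simp_all add: mod_Suc div_Suc)
    have h: "p mod (2 * m) div 2 = m - 1"
      using True by linarith
    have "d [^] (?a * (m * v)) \<otimes> d [^] (Suc ?a * (m * v)) = d [^] (m * v)"
      using d unfolding d_pow_half by auto
    moreover have "d [^] e p = d [^] (m - 1) \<otimes> d [^] (m * v)"
      using True by (simp add: e_def nat_pow_mult[OF d])
    ultimately show ?thesis
      unfolding W_def R2 s h using True d by (simp add: x_def m_ac del: mult_Suc)
  next
    case False
    let ?a = "p div (2 * m)" and ?c = "p mod (2 * m)"
    have s: "Suc p mod (2 * m) = Suc ?c" "Suc p div (2 * m) = ?a"
      using False m_pos by (simp_all add: mod_Suc div_Suc)
    have "c = c div 2 + Suc c div 2" for c :: nat
      by presburger
    then have 1: "?c = ?c div 2 + Suc ?c div 2" .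
    have "d [^] (?a * (m * v)) \<otimes> d [^] (?a * (m * v)) = \<one>"
      using d d_pow_half[of "?a + ?a"] by (simp add: nat_pow_mult add_mult_distrib)
    moreover have "d [^] ?c = d [^] (?c div 2) \<otimes> d [^] (Suc ?c div 2)"
      using d 1 by (metis nat_pow_mult)
    moreover have "a \<otimes> (b \<otimes> t) \<otimes> (a \<otimes> (c \<otimes> t)) = a \<otimes> a \<otimes> (b \<otimes> c) \<otimes> (t \<otimes> t)"
      if "a \<in> carrier G" "b \<in> carrier G" "c \<in> carrier G" "t \<in> carrier G" for a b c t
      using that by (simp add: m_ac)
    ultimately show ?thesis
      unfolding W_def R2 s using False d by (simp add: x_def e_def)
  qed
  have "[e p = p] (mod 2 * m)" for p
  proof (cases "Suc (p mod (2 * m)) = 2 * m")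
    case True
    obtain k where k: "v = 2 * k + 1"
      using odd_V by (elim oddE)
    have "e p = p mod (2 * m) + 2 * m * k"
      using True m_pos by (simp add: e_def k algebra_simps)
    then show ?thesis
      by (simp add: cong_def)
  qed (simp add: e_def cong_def)
  moreover have "[e p = e q] (mod 2 * m)"
    using d_pow_cong[OF xV xV] assms unfolding W by blast
  ultimately have "[p = q] (mod 2 * m)"
    by (meson cong_sym cong_trans)
  then have r: "p mod (2 * m) = q mod (2 * m)"
    by (simp add: cong_def)
  then have "e p = e q"
    by (simp add: e_def)
  then have xx: "x p = x q"
    using assms xG d unfolding W by simp
  have "[p div (2 * m) = q div (2 * m)] (mod v)"
  proof (cases "Suc (p mod (2 * m)) = 2 * m")
    case True
    then have "u (p div (2 * m)) \<otimes> u (Suc (p div (2 * m))) = u (q div (2 * m)) \<otimes> u (Suc (q div (2 * m)))"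
      using xx r by (simp add: x_def)
    then show ?thesis
      using u unfolding harmonious_def by blast
  next
    case False
    then have "u (p div (2 * m)) \<otimes> u (p div (2 * m)) = u (q div (2 * m)) \<otimes> u (q div (2 * m))"
      using xx r by (simp add: x_def)
    then show ?thesis
      using inj_onD[OF inj_on_square[OF V odd_V] _ u_V u_V] u_eq_iff by blast
  qed
  then show ?thesis
    using r by (simp add: cong_mult_iff_nat)
qed

section \<open>Translated ladders and their colour classes\<close>

definition cell :: "'a \<Rightarrow> nat \<Rightarrow> 'a \<times> 'a" where
  "cell h p = (R (p div 2), R (Suc p div 2) \<otimes> h)"

lemma cell_cong:
  assumes "[p = q] (mod 2 * n)"
  shows "cell h p = cell h q"
proof -
  have "[Suc p = Suc q] (mod 2 * n)"
    using assms cong_add_rcancel_nat[of p 1 q] by simp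
  then have "[p div 2 = q div 2] (mod n)" "[Suc p div 2 = Suc q div 2] (mod n)"
    using assms cong_mult_iff_nat by blast+
  then show ?thesis
    unfolding cell_def using R_cong by metis
qed

text \<open>One colour class of the ladder for \<open>h\<close>, with positions counted from
  \<open>t\<close>; the antipodal pair \<open>t\<close>, \<open>t + n\<close> is removed.\<close>

definition half_rungs :: "'a \<Rightarrow> nat \<Rightarrow> nat \<Rightarrow> ('a \<times> 'a) set" where
  "half_rungs h t c = (\<lambda>q. cell h (t + q)) ` {q. 1 \<le> q \<and> q < 2 * n \<and> q \<noteq> n \<and> rung_colour n q = c}"

lemma group_transversal_half_rungs:
  assumes h: "h \<in> carrier G"
  shows "group_transversal G (half_rungs h t c)"
proof -
  let ?Q = "{q. 1 \<le> q \<and> q < 2 * n \<and> q \<noteq> n \<and> rung_colour n q = c}"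
  have inj: "inj_on F ?Q" if F: "\<And>q q'. q \<le> q' \<Longrightarrow> q' < q + (2 * n - 1) \<Longrightarrow> F q = F q' \<Longrightarrow>
      q' \<le> q + 1 \<or> q' = q + n" for F :: "nat \<Rightarrow> 'a"
  proof -
    have *: "q = q'" if "q \<in> ?Q" "q' \<in> ?Q" "q \<le> q'" "F q = F q'" for q q'
      using that F[of q q'] by (intro rung_colour_proper[of n q q']) auto
    show ?thesis
    proof (rule inj_onI)
      fix q q' assume "q \<in> ?Q" "q' \<in> ?Q" "F q = F q'"
      then show "q = q'"
        using *[of q q'] *[of q' q] by (metis nat_le_linear)
    qed
  qed
  show ?thesis
    unfolding half_rungs_def cell_def
  proof (rule group_transversal_image)
    show "inj_on (\<lambda>q. R ((t + q) div 2)) ?Q"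
    proof (rule inj)
      fix q q' assume "q \<le> q'" "q' < q + (2 * n - 1)" "R ((t + q) div 2) = R ((t + q') div 2)"
      then show "q' \<le> q + 1 \<or> q' = q + n"
        using cong_div2_close[of "t + q" "t + q'" n] R_inj by simp
    qed
    show "inj_on (\<lambda>q. R (Suc (t + q) div 2) \<otimes> h) ?Q"
    proof (rule inj)
      fix q q' assume "q \<le> q'" "q' < q + (2 * n - 1)"
        "R (Suc (t + q) div 2) \<otimes> h = R (Suc (t + q') div 2) \<otimes> h"
      then show "q' \<le> q + 1 \<or> q' = q + n"
        using cong_div2_close[of "Suc (t + q)" "Suc (t + q')" n] R_inj h by simp
    qed
    show "inj_on (\<lambda>q. R ((t + q) div 2) \<otimes> (R (Suc (t + q) div 2) \<otimes> h)) ?Q"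
    proof (rule inj)
      fix q q' assume *: "q \<le> q'" "q' < q + (2 * n - 1)"
        and "R ((t + q) div 2) \<otimes> (R (Suc (t + q) div 2) \<otimes> h) = R ((t + q') div 2) \<otimes> (R (Suc (t + q') div 2) \<otimes> h)"
      then have "W (t + q) \<otimes> h = W (t + q') \<otimes> h"
        using h by (simp add: W_def m_assoc)
      then have "W (t + q) = W (t + q')"
        using h by (simp add: W_def)
      then have "[q = q'] (mod n)"
        using W_inj cong_add_lcancel_nat by blast
      then have "q = q' \<or> q = q' + n \<or> q' = q + n"
        using * by (intro cong_cases_nat) auto
      then show "q' \<le> q + 1 \<or> q' = q + n"
        using * by auto
    qed
  qed (use h in auto)
qed

text \<open>The elements \<open>\<eta> \<otimes> d [^] (2 * j)\<close> make up the subgroup of index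
  2, and even \<open>a + b\<close> puts both given elements into one coset of it.\<close>

lemma K_elem:
  assumes "x \<in> V" "y \<in> V" "even (a + b)"
  shows "\<exists>\<eta>\<in>V. \<exists>j<m. x \<otimes> d [^] (a::nat) = y \<otimes> d [^] (b::nat) \<otimes> (\<eta> \<otimes> d [^] (2 * j))"
proof -
  have xy: "x \<in> carrier G" "y \<in> carrier G" "inv y \<in> V"
    using assms V_carrier subgroup.m_inv_closed[OF V] by auto
  define h where "h = x \<otimes> inv y \<otimes> d [^] (a + (n - 1) * b)"
  have n0: "0 < n"
    using m_pos v_pos by simp
  then have nb: "b + (a + (n - 1) * b) = a + n * b"
    by (cases n) auto
  have "y \<otimes> d [^] b \<otimes> (x \<otimes> w \<otimes> d [^] k) = (y \<otimes> w) \<otimes> (x \<otimes> d [^] (b + k))"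
    if "w \<in> carrier G" for w and k :: nat
    using that xy d by (simp add: m_ac nat_pow_mult[symmetric])
  then have "y \<otimes> d [^] b \<otimes> h = (y \<otimes> inv y) \<otimes> (x \<otimes> d [^] (b + (a + (n - 1) * b)))"
    unfolding h_def using xy by simp
  also have "\<dots> = x \<otimes> (d [^] a \<otimes> (d [^] n) [^] b)"
    unfolding nb using xy d by (simp only: nat_pow_mult nat_pow_pow) simp
  also have "\<dots> = x \<otimes> d [^] a"
    unfolding d_pow_n using xy d by simp
  finally have yh: "y \<otimes> d [^] b \<otimes> h = x \<otimes> d [^] a" .
  have "h \<in> carrier G"
    using xy d by (simp add: h_def)
  then have "h \<in> (\<lambda>(v, k). v \<otimes> d [^] k) ` (V \<times> {..<2 * m})"
    using bij_betw_adjoin[OF V d ord_d] by (simp add: gen bij_betw_def)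
  then obtain \<eta> l where l: "\<eta> \<in> V" "l < 2 * m" "h = \<eta> \<otimes> d [^] l"
    by auto
  have "[a + (n - 1) * b = l] (mod 2 * m)"
    by (rule d_pow_cong[OF sub_mult[OF V assms(1) xy(3)] l(1) l(3)[unfolded h_def]])
  then have "even (a + (n - 1) * b) \<longleftrightarrow> even l"
    by (intro cong_dvd_iff cong_dvd_modulus_nat[where m = "2 * m" and n = 2]) simp_all
  moreover have "even (a + (n - 1) * b)"
    using nb assms(3) by (metis even_add even_mult_iff dvd_triv_left)
  ultimately have "even l"
    by blast
  then obtain j where "l = 2 * j" ..
  then show ?thesis
    using l yh by (intro bexI[of _ \<eta>] exI[of _ j]) auto
qed

text \<open>In row \<open>R i\<close> the untranslated ladder has the columns \<open>R i\<close> and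
  \<open>R (Suc i)\<close>, one from each coset of the subgroup of index 2, so a translation takes
  one of them to \<open>y\<close>.\<close>

lemma cell_surj:
  assumes "x \<in> carrier G" "y \<in> carrier G"
  shows "\<exists>\<eta>\<in>V. \<exists>j<m. \<exists>p. (x, y) = cell (\<eta> \<otimes> d [^] (2 * j)) p"
proof -
  obtain i where i: "R i = x"
    using R_surj[OF assms(1)] .
  obtain z and k :: nat where z: "z \<in> V" "y = z \<otimes> d [^] k"
    using assms(2) unfolding gen[symmetric] adjoin_def by blast
  have "\<exists>\<eta>\<in>V. \<exists>j<m. y = R i' \<otimes> (\<eta> \<otimes> d [^] (2 * j))" if "even (k + E i')" for i'
    unfolding R_def z(2) using K_elem[OF z(1) u_V that] .
  moreover have "even (k + E i) \<or> even (k + E (Suc i))"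
    using E_Suc[of i] by auto
  moreover have "cell h (2 * i) = (x, R i \<otimes> h)" "cell h (2 * i + 1) = (x, R (Suc i) \<otimes> h)" for h
    by (simp_all add: cell_def i)
  ultimately show ?thesis
    by metis
qed

section \<open>The removed antipodal pairs\<close>

lemma leftover_position:
  assumes "\<eta> \<in> V" "j < m"
  shows "\<exists>t. R (t div 2) = f \<eta> \<otimes> d [^] row_exp m j \<and>
    R (Suc t div 2) = f \<eta> \<otimes> d [^] (row_exp m j + j mod 2)"
proof -
  have fV: "f \<eta> \<in> V"
    using assms f by (auto simp: strong_map_def)
  show ?thesis
  proof (cases "even j")
    case True
    have "f \<eta> \<otimes> d [^] row_exp m j \<in> carrier G"
      using V_carrier[OF fV] d by simp
    then obtain i where "R i = f \<eta> \<otimes> d [^] row_exp m j"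
      using R_surj by blast
    then show ?thesis
      using True by (intro exI[of _ "2 * i"]) simp
  next
    case False
    then have X: "Suc (row_exp m j) < m"
      using assms(2) by (auto simp: row_exp_def elim!: oddE)
    have "inj_on u {..<v}"
      by (rule inj_onI) (use u_eq_iff cong_less_modulus_unique_nat in blast)
    then have "u ` {..<v} = V"
      using sub_finite[OF V] u_V by (intro card_subset_eq) (auto simp: card_image)
    then obtain a0 where a0: "u a0 = f \<eta>"
      using fV by (metis imageE)
    \<comment> \<open>An even block carries no involution factor; adding the odd period
      \<open>v\<close> corrects the parity without changing the term of \<open>u\<close>. Inside the
      block one step multiplies by \<open>d\<close>, as odd \<open>j\<close> requires.\<close>
    define a where "a = (if even a0 then a0 else a0 + v)"
    have a: "u a = f \<eta>" "even a"
      using a0 odd_V u_eq_iff[of "a0 + v" a0] by (auto simp: a_def cong_def)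
    have Ra: "R (a * m + b) = f \<eta> \<otimes> d [^] b" if "b < m" for b
      using that a d fV V_carrier d_pow_half[of a] by (simp add: R_eq)
    show ?thesis
      using False Ra[of "row_exp m j"] Ra[of "Suc (row_exp m j)"] X
      by (intro exI[of _ "2 * (a * m + row_exp m j) + 1"]) (simp add: odd_iff_mod_2_eq_one)
  qed
qed

lemma inj_on_coordinates:
  assumes "g ` V \<subseteq> V" "inj_on g V"
    and "\<And>j k. j < m \<Longrightarrow> k < m \<Longrightarrow> [e j = e k] (mod 2 * m) \<Longrightarrow> j = k"
  shows "inj_on (\<lambda>(\<eta>, j). g \<eta> \<otimes> d [^] (e j :: nat)) (V \<times> {..<m})"
proof (clarsimp simp: inj_on_def)
  fix x y j k assume *: "x \<in> V" "y \<in> V" "j < m" "k < m" "g x \<otimes> d [^] e j = g y \<otimes> d [^] e k"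
  then have "j = k"
    using assms d_pow_cong by blast
  moreover have "g x \<in> carrier G" "g y \<in> carrier G"
    using * assms(1) V_carrier by auto
  ultimately have "g x = g y"
    using * d by simp
  then show "x = y \<and> j = k"
    using * assms(2) \<open>j = k\<close> by (auto dest: inj_onD)
qed

text \<open>Taking \<open>s\<close> to be the identity or \<open>d [^] (m * v)\<close> gives the two
  halves of the removed pairs. Rows and columns are merely translated by \<open>s\<close>, which
  cancels in the symbols; \<open>strong_map\<close> then separates \<open>V\<close>-parts and
  \<open>row_exp_inj\<close> separates exponents.\<close>

lemma group_transversal_leftover:
  assumes s: "s \<in> carrier G" "s \<otimes> s = \<one>"
  shows "group_transversal G ((\<lambda>(\<eta>, j). (f \<eta> \<otimes> d [^] row_exp m j \<otimes> s,
    f \<eta> \<otimes> d [^] (row_exp m j + j mod 2) \<otimes> s \<otimes> (\<eta> \<otimes> d [^] (2 * j)))) ` (V \<times> {..<m}))"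
proof -
  have fV: "f x \<in> V" "f x \<in> carrier G" if "x \<in> V" for x
    using that f V_carrier by (auto simp: strong_map_def)
  let ?D = "V \<times> {..<m}"
  let ?r = "\<lambda>z. f (fst z) \<otimes> d [^] row_exp m (snd z)"
  let ?c = "\<lambda>z. f (fst z) \<otimes> fst z \<otimes> d [^] (row_exp m (snd z) + (snd z mod 2 + 2 * snd z))"
  let ?s = "\<lambda>z. f (fst z) \<otimes> f (fst z) \<otimes> fst z \<otimes> d [^] (2 * row_exp m (snd z) + (snd z mod 2 + 2 * snd z))"
  have G: "?r z \<in> carrier G" "?c z \<in> carrier G" "?s z \<in> carrier G" if "z \<in> ?D" for z
    using that fV V_carrier d by (auto simp: mem_Times_iff)
  have r: "inj_on ?r ?D"
    using inj_on_coordinates[of f "row_exp m"] f row_exp_inj(1)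
    by (simp add: strong_map_def case_prod_unfold)
  have c: "inj_on ?c ?D"
    using inj_on_coordinates[of "\<lambda>x. f x \<otimes> x" "\<lambda>j. row_exp m j + (j mod 2 + 2 * j)"] f row_exp_inj(2)
      fV sub_mult[OF V] by (simp add: strong_map_def case_prod_unfold image_subset_iff)
  have w: "inj_on ?s ?D"
    using inj_on_coordinates[of "\<lambda>x. f x \<otimes> f x \<otimes> x" "\<lambda>j. 2 * row_exp m j + (j mod 2 + 2 * j)"] f
      row_exp_inj(3) fV sub_mult[OF V] by (simp add: strong_map_def case_prod_unfold image_subset_iff)
  have shift: "inj_on (\<lambda>z. F z \<otimes> s) ?D" if "inj_on F ?D" "\<And>z. z \<in> ?D \<Longrightarrow> F z \<in> carrier G" for F
    using that s(1) by (auto simp: inj_on_def)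
  have "group_transversal G ((\<lambda>z. (?r z \<otimes> s, ?c z \<otimes> s)) ` ?D)"
  proof (rule group_transversal_image)
    have "?r z \<otimes> s \<otimes> (?c z \<otimes> s) = ?s z" if "z \<in> ?D" for z
    proof -
      have "?r z \<otimes> s \<otimes> (?c z \<otimes> s) = ?r z \<otimes> ?c z \<otimes> (s \<otimes> s)"
        using G[OF that] s(1) by (simp only: m_ac m_closed)
      also have "\<dots> = ?s z"
        using that fV V_carrier d s by (auto simp: mem_Times_iff m_ac mult_2 nat_pow_mult[symmetric])
      finally show ?thesis .
    qed
    then show "inj_on (\<lambda>z. ?r z \<otimes> s \<otimes> (?c z \<otimes> s)) ?D"
      using w by (simp cong: inj_on_cong)
  qed (use shift r c G s in auto)
  also have "(\<lambda>z. (?r z \<otimes> s, ?c z \<otimes> s)) ` ?D = (\<lambda>(\<eta>, j). (f \<eta> \<otimes> d [^] row_exp m j \<otimes> s,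
    f \<eta> \<otimes> d [^] (row_exp m j + j mod 2) \<otimes> s \<otimes> (\<eta> \<otimes> d [^] (2 * j)))) ` ?D"
    using fV V_carrier d s by (intro image_cong refl)
      (auto simp: mem_Times_iff m_ac nat_pow_mult[symmetric])
  finally show ?thesis .
qed

text \<open>The \<open>n / 2\<close> translations contribute two colour classes each;
  \<open>A\<close> and \<open>B\<close> collect the removed cells.\<close>

lemma ex_cover:
  "\<exists>F. finite F \<and> card F \<le> n + 2 \<and> (\<forall>T\<in>F. group_transversal G T) \<and> carrier G \<times> carrier G \<subseteq> \<Union>F"
proof -
  let ?D = "V \<times> {..<m}"
  define h where "h = (\<lambda>(\<eta>, j). \<eta> \<otimes> d [^] (2 * j :: nat))"
  have hG: "h z \<in> carrier G" if "z \<in> ?D" for z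
    using that d V_carrier by (auto simp: h_def)
  define t where "t = (\<lambda>(\<eta>, j). SOME t. R (t div 2) = f \<eta> \<otimes> d [^] row_exp m j \<and>
    R (Suc t div 2) = f \<eta> \<otimes> d [^] (row_exp m j + j mod 2))"
  have t: "R (t (\<eta>, j) div 2) = f \<eta> \<otimes> d [^] row_exp m j \<and>
    R (Suc (t (\<eta>, j)) div 2) = f \<eta> \<otimes> d [^] (row_exp m j + j mod 2)" if "(\<eta>, j) \<in> ?D" for \<eta> j
    unfolding t_def using someI_ex[OF leftover_position[of \<eta> j]] that by simp
  define A where "A = (\<lambda>z. cell (h z) (t z)) ` ?D"
  define B where "B = (\<lambda>z. cell (h z) (t z + n)) ` ?D"
  define F where "F = (\<lambda>(z, c). half_rungs (h z) (t z) c) ` (?D \<times> {..<2}) \<union> {A, B}"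
  have "A = (\<lambda>(\<eta>, j). (f \<eta> \<otimes> d [^] row_exp m j \<otimes> \<one>,
    f \<eta> \<otimes> d [^] (row_exp m j + j mod 2) \<otimes> \<one> \<otimes> (\<eta> \<otimes> d [^] (2 * j)))) ` ?D"
    unfolding A_def
  proof (rule image_cong[OF refl])
    fix z assume z: "z \<in> ?D"
    obtain \<eta> j where [simp]: "z = (\<eta>, j)"
      by (cases z)
    have "f \<eta> \<in> carrier G"
      using z f V_carrier by (auto simp: strong_map_def)
    then show "cell (h z) (t z) = (\<lambda>(\<eta>, j). (f \<eta> \<otimes> d [^] row_exp m j \<otimes> \<one>,
      f \<eta> \<otimes> d [^] (row_exp m j + j mod 2) \<otimes> \<one> \<otimes> (\<eta> \<otimes> d [^] (2 * j)))) z"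
      using t[of \<eta> j] z d by (simp add: cell_def h_def)
  qed
  then have A: "group_transversal G A"
    using group_transversal_leftover[of \<one>] by simp
  have "B = (\<lambda>(\<eta>, j). (f \<eta> \<otimes> d [^] row_exp m j \<otimes> d [^] (m * v),
    f \<eta> \<otimes> d [^] (row_exp m j + j mod 2) \<otimes> d [^] (m * v) \<otimes> (\<eta> \<otimes> d [^] (2 * j)))) ` ?D"
    unfolding B_def
  proof (rule image_cong[OF refl])
    fix z assume z: "z \<in> ?D"
    obtain \<eta> j where [simp]: "z = (\<eta>, j)"
      by (cases z)
    have "(p + n) div 2 = p div 2 + m * v" "Suc (p + n) div 2 = Suc p div 2 + m * v" for p
      by simp_all
    then show "cell (h z) (t z + n) = (\<lambda>(\<eta>, j). (f \<eta> \<otimes> d [^] row_exp m j \<otimes> d [^] (m * v),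
      f \<eta> \<otimes> d [^] (row_exp m j + j mod 2) \<otimes> d [^] (m * v) \<otimes> (\<eta> \<otimes> d [^] (2 * j)))) z"
      using t[of \<eta> j] z by (simp only: cell_def R_add_half h_def case_prod_conv) simp
  qed
  moreover have "d [^] (m * v) \<otimes> d [^] (m * v) = \<one>"
    using d d_pow_half[of 2] by (simp add: nat_pow_mult mult_2 add_mult_distrib)
  ultimately have B: "group_transversal G B"
    using group_transversal_leftover[of "d [^] (m * v)"] d by simp
  have fin: "finite ?D"
    using sub_finite[OF V] by simp
  have "card F \<le> card (?D \<times> {..<2::nat}) + card {A, B}"
    unfolding F_def using fin by (intro order_trans[OF card_Un_le] add_mono card_image_le) auto
  also have "\<dots> \<le> n + 2"
    by (simp add: card_cartesian_product card_insert_if)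
  finally have "card F \<le> n + 2" .
  moreover have "finite F"
    unfolding F_def using fin by simp
  moreover have "group_transversal G T" if "T \<in> F" for T
    using that A B group_transversal_half_rungs hG unfolding F_def by auto
  moreover have "(x, y) \<in> \<Union>F" if xy_G: "x \<in> carrier G" "y \<in> carrier G" for x y
  proof -
    obtain \<eta> j p where p: "\<eta> \<in> V" "j < m" "(x, y) = cell (\<eta> \<otimes> d [^] (2 * j)) p"
      using cell_surj[OF xy_G] by blast
    define z where "z = (\<eta>, j)"
    have z: "z \<in> ?D" "(x, y) = cell (h z) p"
      using p by (auto simp: z_def h_def)
    \<comment> \<open>The position \<open>p\<close> counted from \<open>t z\<close>, with
      \<open>2 * n - 1\<close> standing for -1.\<close>
    define q where "q = (p + (2 * n - 1) * t z) mod (2 * n)"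
    have n0: "0 < n"
      using m_pos v_pos by simp
    then have "t z + (p + (2 * n - 1) * t z) = p + 2 * n * t z"
      by (cases n) auto
    then have "[t z + q = p] (mod 2 * n)"
      unfolding q_def cong_def by (metis mod_add_right_eq mod_mult_self2)
    then have xy: "(x, y) = cell (h z) (t z + q)"
      using z(2) cell_cong by metis
    have "q < 2 * n"
      using n0 by (simp add: q_def)
    then consider "q = 0" | "q = n" | "1 \<le> q" "q < 2 * n" "q \<noteq> n"
      by linarith
    then show ?thesis
    proof cases
      case 1
      then have "(x, y) \<in> A"
        using xy z(1) by (auto simp: A_def)
      then show ?thesis
        by (simp add: F_def)
    next
      case 2
      then have "(x, y) \<in> B"
        using xy z(1) by (auto simp: B_def)
      then show ?thesis
        by (simp add: F_def)
    next
      case 3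
      then have "(x, y) \<in> half_rungs (h z) (t z) (rung_colour n q)"
        unfolding xy half_rungs_def by blast
      moreover have "rung_colour n q \<in> {..<2}"
        by (simp add: rung_colour_def)
      ultimately show ?thesis
        unfolding F_def using z(1) by blast
    qed
  qed
  ultimately show ?thesis
    by blast
qed

end

section \<open>Groups with a cyclic Sylow 2-subgroup\<close>

context finite_comm_group
begin

text \<open>Otherwise adjoining \<open>x\<close> would double \<open>P\<close>, and by Lagrange the
  order of \<open>G\<close> would contain one more factor 2.\<close>

lemma sylow2_involution:
  assumes P: "sylow_subgroup 2 P G" and x: "x \<in> carrier G" "x \<otimes> x = \<one>"
  shows "x \<in> P"
proof -
  have sub: "subgroup P G" and card: "card P = 2 ^ multiplicity 2 (order G)"
    using P by (auto simp: sylow_subgroup_def)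
  have pos: "order G \<noteq> 0"
    using finite_carrier order_gt_0_iff_finite by simp
  obtain N where N: "rel_order P x N"
    using ex_rel_order[OF sub x(1)] .
  have "x [^] (2::nat) \<in> P"
    using x subgroup.one_closed[OF sub] by (simp add: numeral_2_eq_2)
  then have "N dvd 2"
    using N by (simp add: rel_order_def)
  then have "N = 1 \<or> N = 2"
    using dvd_imp_le[of N 2] N by (auto simp: rel_order_def numeral_2_eq_2 le_Suc_eq)
  moreover have "N \<noteq> 2"
  proof
    assume "N = 2"
    then have "card (adjoin P x) = 2 ^ Suc (multiplicity 2 (order G))"
      using card_adjoin[OF sub x(1)] N card by simp
    moreover have "card (adjoin P x) dvd order G"
      using lagrange[OF sub_adjoin[OF sub x(1)]] by (metis dvd_triv_right)
    ultimately have "2 ^ Suc (multiplicity 2 (order G)) dvd order G"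
      by simp
    then have "Suc (multiplicity 2 (order G)) \<le> multiplicity 2 (order G)"
      using pos by (intro multiplicity_geI) simp_all
    then show False
      by simp
  qed
  ultimately have "x [^] k \<in> P" for k :: nat
    using N by (simp add: rel_order_def)
  from this[of 1] show ?thesis
    using x by simp
qed

text \<open>For a generator \<open>c\<close>, the exponent of an involution is an odd multiple of
  half of \<open>ord c\<close>; two such exponents differ by a multiple of
  \<open>ord c\<close>.\<close>

lemma cyclic_involution_unique:
  assumes P: "subgroup P G" and cyc: "cyclic_group (G\<lparr>carrier := P\<rparr>)"
    and x: "x \<in> P" "x \<otimes> x = \<one>" "x \<noteq> \<one>" and y: "y \<in> P" "y \<otimes> y = \<one>" "y \<noteq> \<one>"
  shows "x = y"
proof -
  interpret H: group "G\<lparr>carrier := P\<rparr>"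
    by (rule subgroup_imp_group[OF P])
  obtain c where c: "c \<in> P" "P = range (\<lambda>n::int. c [^]\<^bsub>G\<lparr>carrier := P\<rparr>\<^esub> n)"
    using cyc unfolding H.cyclic_group by auto
  then have P_eq: "P = range (\<lambda>n::int. c [^] n)"
    by (simp add: int_pow_consistent[OF P, symmetric])
  have cG: "c \<in> carrier G"
    using c sub_carrier[OF P] by blast
  have pow: "\<exists>k q. z = c [^] (k::int) \<and> 2 * k = int (ord c) * q \<and> odd q"
    if "z \<in> P" "z \<otimes> z = \<one>" "z \<noteq> \<one>" for z
  proof -
    obtain k :: int where k: "z = c [^] k"
      using \<open>z \<in> P\<close> P_eq by auto
    have "c [^] (2 * k) = c [^] k \<otimes> c [^] k"
      unfolding mult_2 by (rule int_pow_mult[OF cG])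
    then have "c [^] (2 * k) = \<one>"
      using \<open>z \<otimes> z = \<one>\<close> by (simp only: k)
    then have "int (ord c) dvd 2 * k"
      by (simp only: int_pow_eq_id[OF cG])
    then obtain q where q: "2 * k = int (ord c) * q" ..
    have "odd q"
    proof
      assume "even q"
      then obtain r where "q = 2 * r" ..
      then have "k = int (ord c) * r"
        using q by simp
      then have "c [^] k = \<one>"
        by (simp add: int_pow_eq_id[OF cG])
      then show False
        using \<open>z \<noteq> \<one>\<close> k by simp
    qed
    then show ?thesis
      using k q by blast
  qed
  obtain k q where k: "x = c [^] (k::int)" "2 * k = int (ord c) * q" "odd q"
    using pow[OF x] by blast
  obtain l r where l: "y = c [^] (l::int)" "2 * l = int (ord c) * r" "odd r"
    using pow[OF y] by blast
  have "even (q - r)"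
    using k(3) l(3) by simp
  then obtain s where s: "q - r = 2 * s" ..
  have "2 * (k - l) = int (ord c) * (q - r)"
    using k(2) l(2) by (simp add: right_diff_distrib)
  also have "\<dots> = 2 * (int (ord c) * s)"
    by (simp add: s)
  finally have "k - l = int (ord c) * s"
    by simp
  then have "int (ord c) dvd k - l"
    by simp
  then show ?thesis
    using cG by (simp add: k(1) l(1) int_pow_eq dvd_diff_commute)
qed

end

theorem theorem2p3:
  fixes G :: "('a, 'b) monoid_scheme" and n :: nat and g :: "nat \<Rightarrow> 'a"
  assumes "comm_group G" and "finite (carrier G)" and "order G = n"
    and "bij_betw g {..<n} (carrier G)"
    and "\<And>P. sylow_subgroup 2 P G \<Longrightarrow>
           cyclic_group (G\<lparr>carrier := P\<rparr>) \<and> P \<noteq> {\<one>\<^bsub>G\<^esub>}"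
  shows "chromatic_number n (cayley_table G g) \<le> n + 2"
proof -
  interpret finite_comm_group G
    using assms(1,2) by (simp add: finite_comm_group_def finite_comm_group_axioms_def)
  have pos: "0 < order G"
    using finite_carrier order_gt_0_iff_finite by simp
  have "2 ^ multiplicity 2 (order G) dvd order G"
    by (rule multiplicity_dvd)
  then obtain P where P: "sylow_subgroup 2 P G"
    using sylow_thm[of 2 G "multiplicity 2 (order G)"] finite_carrier is_group
    unfolding sylow_subgroup_def by (auto elim!: dvdE)
  have sub: "subgroup P G" and card: "card P = 2 ^ multiplicity 2 (order G)"
    using P by (auto simp: sylow_subgroup_def)
  have "P \<noteq> {\<one>\<^bsub>G\<^esub>}"
    using assms(5)[OF P] by blast
  then have "card P \<noteq> 1"
    using subgroup.one_closed[OF sub] by (metis card_1_singletonE singletonD)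
  then have "multiplicity 2 (order G) \<noteq> 0"
    using card by (intro notI) simp
  then have even: "even (order G)"
    by (rule contrapos_np) (rule not_dvd_imp_multiplicity_0)
  have "x = y" if "x \<in> carrier G" "y \<in> carrier G" "x \<otimes>\<^bsub>G\<^esub> x = \<one>\<^bsub>G\<^esub>" "y \<otimes>\<^bsub>G\<^esub> y = \<one>\<^bsub>G\<^esub>"
    "x \<noteq> \<one>\<^bsub>G\<^esub>" "y \<noteq> \<one>\<^bsub>G\<^esub>" for x y
    using cyclic_involution_unique[OF sub] assms(5)[OF P] sylow2_involution[OF P] that by blast
  then obtain V d where V: "good V" and d: "d \<in> carrier G" "adjoin V d = carrier G"
    using ex_good_generator by blast
  then obtain u f where V': "subgroup V G" "odd (card V)" "harmonious V u" "strong_map V f"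
    unfolding good_def by blast
  obtain N where N: "rel_order V d N"
    using ex_rel_order[OF V'(1) d(1)] .
  have "order G = N * card V"
    using card_adjoin[OF V'(1) d(1) N] d(2) by (simp add: order_def)
  \<comment> \<open>The factor 2 of the group order must lie in the cyclic quotient, as
    \<open>card V\<close> is odd.\<close>
  then obtain m where m: "N = 2 * m"
    using even V'(2) by (metis even_mult_iff dvdE)
  interpret ladder G V u f d m
    by (rule ladder.intro[OF finite_comm_group_axioms ladder_axioms.intro])
      (fact V' d N[unfolded m])+
  obtain F where F: "finite F" "card F \<le> 2 * m * card V + 2" "\<And>T. T \<in> F \<Longrightarrow> group_transversal G T"
    "carrier G \<times> carrier G \<subseteq> \<Union>F"
    using ex_cover by blast
  have "n = 2 * m * card V"
    using assms(3) card_G by (simp add: order_def)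
  then show ?thesis
    using chromatic_number_cayley_table_le[OF assms(4) F(1,3,4)] F(2) by simp
qed

end
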